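(* Let $A\in\mathbb{Z}$, $A\geq 2$, let $B\subset\mathbb{Z}$ be a finite set with $0\in B$, and consider the affine iterated function system $\tau_b(x)=A^{-1}(x+b)$, $x\in\mathbb{R}$, $b\in B$. Assume the following conditions are satisfied: (a) $A=a^p$ for some positive integers $a$ and $p$. (b) $B=\bigoplus_{k=0}^{p-1}a^{n_kp+k}C_k$ for some integers $n_0,\dots,n_{p-1}\geq 0$ and some subsets $C_0,\dots,C_{p-1}$ of $\mathbb{Z}$. (c) For each $k\in\{0,\dots,p-1\}$, the finite set $C_k$ has spectrum $\frac{1}{a}L_k$ for some subset $L_k$ of $\mathbb{Z}$. (d) $\gcd(C_0)=1$. Then the invariant measure $\mu_B$ of the system $(\tau_b)_{b\in B}$ is a spectral measure.
   Context: For $\lambda\in\mathbb{R}$ let $e_\lambda(x)=e^{2\pi i\lambda x}$. A finite Borel measure $\mu$ on $\mathbb{R}$ is spectral if there is a set $\Lambda\subset\mathbb{R}$ such that the family $(e_\lambda)_{\lambda\in\Lambda}$ is an orthogonal basis of $L^2(\mu)$; then $\Lambda$ is called a spectrum for $\mu$. A finite set $C\subset\mathbb{R}$ has spectrum $\Lambda$ if $\Lambda$ is a spectrum for the measure $\delta_C=\frac{1}{\#C}\sum_{c\in C}\delta_c$ ($\delta_c$ the Dirac measure at $c$). The invariant measure $\mu_B$ of the affine iterated function system $(\tau_b)_{b\in B}$ is the unique Borel probability measure on $\mathbb{R}$ such that $\int f\,d\mu_B=\frac{1}{\#B}\sum_{b\in B}\int f\circ\tau_b\,d\mu_B$ for all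 $f\in C_c(\mathbb{R})$. The notation $C=A_1\oplus A_2$ (and similarly for several summands) means that $C=A_1+A_2$ and every $c\in C$ can be written uniquely as $c=a_1+a_2$ with $a_1\in A_1$, $a_2\in A_2$. For a set $C$ of integers, $\gcd(C)$ is the greatest common divisor of its elements. *)

theory Defs
  imports "HOL-Probability.Probability"
begin

subsection \<open>Orthogonal bases of \<open>L\<^sup>2\<close> and spectral measures\<close>

text \<open>
  Elements of \<open>L\<^sup>2(M)\<close> are represented by functions; equality almost everywhere is
  accounted for by only ever using the inner product and the seminorm.
\<close>

definition square_integrable :: "'a measure \<Rightarrow> ('a \<Rightarrow> complex) set" where
  "square_integrable M =
     {f \<in> borel_measurable M. integrable M (\<lambda>x. (cmod (f x))\<^sup>2)}"

definition L2_inner :: "'a measure \<Rightarrow> ('a \<Rightarrow> complex) \<Rightarrow> ('a \<Rightarrow> complex) \<Rightarrow> complex" where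
  "L2_inner M f g = (\<integral>x. f x * cnj (g x) \<partial>M)"

definition L2_norm :: "'a measure \<Rightarrow> ('a \<Rightarrow> complex) \<Rightarrow> real" where
  "L2_norm M f = sqrt (\<integral>x. (cmod (f x))\<^sup>2 \<partial>M)"

text \<open>
  An orthogonal basis is a family of nonzero, pairwise orthogonal vectors whose linear span
  is dense.
\<close>

definition orthogonal_basis_L2 :: "'a measure \<Rightarrow> ('i \<Rightarrow> 'a \<Rightarrow> complex) \<Rightarrow> 'i set \<Rightarrow> bool" where
  "orthogonal_basis_L2 M e I \<longleftrightarrow>
     (\<forall>i\<in>I. e i \<in> square_integrable M \<and> L2_norm M (e i) \<noteq> 0) \<and>
     (\<forall>i\<in>I. \<forall>j\<in>I. i \<noteq> j \<longrightarrow> L2_inner M (e i) (e j) = 0) \<and>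
     (\<forall>f\<in>square_integrable M. \<forall>\<epsilon>>0. \<exists>F c. finite F \<and> F \<subseteq> I \<and>
        L2_norm M (\<lambda>x. f x - (\<Sum>i\<in>F. c i * e i x)) < \<epsilon>)"

definition expo :: "real \<Rightarrow> real \<Rightarrow> complex" where
  "expo l x = exp (2 * of_real pi * \<i> * of_real l * of_real x)"

definition is_spectrum :: "real measure \<Rightarrow> real set \<Rightarrow> bool" where
  "is_spectrum M \<Lambda> \<longleftrightarrow> orthogonal_basis_L2 M expo \<Lambda>"

definition spectral_measure :: "real measure \<Rightarrow> bool" where
  "spectral_measure M \<longleftrightarrow>
     finite_measure M \<and> sets M = sets borel \<and> (\<exists>\<Lambda>. is_spectrum M \<Lambda>)"

definition uniform_dirac :: "real set \<Rightarrow> real measure" where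
  "uniform_dirac C =
     measure_of UNIV (sets borel)
       (\<lambda>X. (1 / of_nat (card C)) * (\<Sum>c\<in>C. emeasure (return borel c) X))"

definition set_has_spectrum :: "real set \<Rightarrow> real set \<Rightarrow> bool" where
  "set_has_spectrum C \<Lambda> \<longleftrightarrow> finite C \<and> C \<noteq> {} \<and> is_spectrum (uniform_dirac C) \<Lambda>"

lemma sets_uniform_dirac [simp, measurable_cong]: "sets (uniform_dirac C) = sets borel"
  unfolding uniform_dirac_def
  by (metis sets.sets_measure_of_eq space_borel)

lemma emeasure_uniform_dirac:
  assumes X: "X \<in> sets borel"
  shows "emeasure (uniform_dirac C) X =
    (1 / of_nat (card C)) * (\<Sum>c\<in>C. emeasure (return borel c) X)"
proof (rule emeasure_measure_of[OF uniform_dirac_def])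
  show "sets borel \<subseteq> Pow (UNIV :: real set)"
    by simp
  show "X \<in> sets (uniform_dirac C)"
    using X by simp
  show "positive (sets (uniform_dirac C))
      (\<lambda>X. 1 / of_nat (card C) * (\<Sum>c\<in>C. emeasure (return borel c) X))"
    by (simp add: positive_def)
  show "countably_additive (sets (uniform_dirac C))
      (\<lambda>X. 1 / of_nat (card C) * (\<Sum>c\<in>C. emeasure (return borel c) X))"
  proof (rule countably_additiveI)
    fix Y :: "nat \<Rightarrow> real set"
    assume Y: "range Y \<subseteq> sets (uniform_dirac C)" "disjoint_family Y"
    have "(\<Sum>i. emeasure (return borel c) (Y i)) = emeasure (return borel c) (\<Union>i. Y i)" for c
      by (rule suminf_emeasure) (use Y in auto)
    moreover have "(\<Sum>i. \<Sum>c\<in>C. emeasure (return borel c) (Y i)) =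
        (\<Sum>c\<in>C. \<Sum>i. emeasure (return borel c) (Y i))"
      by (rule suminf_sum) simp
    ultimately show "(\<Sum>i. 1 / of_nat (card C) * (\<Sum>c\<in>C. emeasure (return borel c) (Y i))) =
        1 / of_nat (card C) * (\<Sum>c\<in>C. emeasure (return borel c) (\<Union>i. Y i))"
      by simp
  qed
qed


subsection \<open>Invariant measures of affine iterated function systems\<close>

definition is_invariant_measure ::
  "('i \<Rightarrow> real \<Rightarrow> real) \<Rightarrow> 'i set \<Rightarrow> real measure \<Rightarrow> bool" where
  "is_invariant_measure \<tau> B \<mu> \<longleftrightarrow>
     prob_space \<mu> \<and> sets \<mu> = sets borel \<and>
     (\<forall>f :: real \<Rightarrow> complex.
        continuous_on UNIV f \<and> compact (closure {x. f x \<noteq> 0}) \<longrightarrow>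
        (\<integral>x. f x \<partial>\<mu>) = 1 / of_nat (card B) * (\<Sum>b\<in>B. \<integral>x. (f \<circ> \<tau> b) x \<partial>\<mu>))"

definition invariant_measure :: "('i \<Rightarrow> real \<Rightarrow> real) \<Rightarrow> 'i set \<Rightarrow> real measure" where
  "invariant_measure \<tau> B = (THE \<mu>. is_invariant_measure \<tau> B \<mu>)"

definition affine_ifs :: "int \<Rightarrow> int \<Rightarrow> real \<Rightarrow> real" where
  "affine_ifs A b x = inverse (of_int A) * (x + of_int b)"


subsection \<open>Direct sums of sets of integers\<close>

definition is_direct_sum :: "'i set \<Rightarrow> ('i \<Rightarrow> int set) \<Rightarrow> int set \<Rightarrow> bool" where
  "is_direct_sum I S C \<longleftrightarrow>
     C = {\<Sum>i\<in>I. x i | x. x \<in> Pi\<^sub>E I S} \<and>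
     (\<forall>c\<in>C. \<exists>!x. x \<in> Pi\<^sub>E I S \<and> c = (\<Sum>i\<in>I. x i))"

end

(*
  By the refinement equation of the Fourier transform, |mu^| = W * phi after rescaling: phi is the
  infinite product of the masks of the digit sets C_k placed at level k, and W is the product of the
  finitely many masks that remain because C_k actually sits at level n_k p + k.  The C_k
  have spectra in (1/a)Z, so partial products satisfy discrete Parseval identities, and the finite level
  spectra can be corrected by multiples of powers of A without affecting these identities.  If phi
  has no periodic zero (a point x with phi = 0 on x + Z), then the corrections can be chosen so that
  phi is bounded below along them, and dominated convergence gives Parseval for mu itself.  The
  periodic zeros form a finite set on which x -> A x mod 1 acts and on which the mask is 1 in
  absolute value; after dividing by the gcd of all differences within the C_k (the rescaling),
  such points are integers, where phi does not vanish.  Completeness then follows from the density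
  of trigonometric polynomials in L^2.
*)

theory Submission
  imports Defs
begin

subsection \<open>Fourier transforms and means of exponentials\<close>

text \<open>If n_k > 0, the digits in the k-th summand of \<open>B\<close> are all divisible by
  \<open>A\<close>, and when there are several of them, exponentials with frequencies in (1/A)Z
  cannot tell them apart. So the mask of \<open>B\<close> has no Parseval identity over such
  frequencies. Over all scales, however, the mask of C_k is evaluated at a^(k + i p) x for every
  integer i < n_k. The negative i form an infinite product adapted to \<open>A\<close>; the finitely
  many i >= 0 form the factor that does not contract. No lower bound for that factor is sought: it
  enters the partial products and the limit alike, and only the tail of the infinite product
  separates the two.

  All identities are between moduli. After the rescaling the differences within a digit set are
  integers while the digits themselves may not be; the modulus discards the phase common to a digit
  set, and this makes every mask 1-periodic.\<close>

definition fourier_transform :: "real measure \<Rightarrow> real \<Rightarrow> complex" where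
  "fourier_transform M t = (\<integral>x. expo t x \<partial>M)"

definition trig_mean :: "int set \<Rightarrow> real \<Rightarrow> complex" where
  "trig_mean C x = (\<Sum>c\<in>C. expo (of_int c) x) / of_nat (card C)"

lemma expo_eq_cis: "expo l x = cis (2 * pi * l * x)"
  by (simp add: expo_def cis_conv_exp mult_ac)

lemma norm_expo [simp]: "cmod (expo l x) = 1"
  by (simp add: expo_eq_cis)

lemma expo_0 [simp]: "expo 0 x = 1" "expo l 0 = 1"
  by (simp_all add: expo_eq_cis)

lemma expo_commute: "expo l x = expo x l"
  by (simp add: expo_eq_cis mult_ac)

lemma expo_add_left: "expo (s + t) x = expo s x * expo t x"
  by (simp add: expo_eq_cis cis_mult algebra_simps)

lemma expo_add_right: "expo s (x + y) = expo s x * expo s y"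
  by (simp add: expo_eq_cis cis_mult algebra_simps)

lemma expo_sum_left: "expo (\<Sum>i\<in>I. s i) x = (\<Prod>i\<in>I. expo (s i) x)"
  by (induction I rule: infinite_finite_induct) (simp_all add: expo_add_left)

lemma cnj_expo: "cnj (expo s x) = expo (- s) x"
  by (simp add: expo_eq_cis cis_cnj)

lemma expo_of_int_eq_1: "s * x \<in> \<int> \<Longrightarrow> expo s x = 1"
  by (auto simp: expo_eq_cis cis_multiple_2pi simp flip: mult.assoc elim!: Ints_cases)
     (metis Ints_of_int cis_multiple_2pi mult.assoc)

lemma expo_mult_cnj: "expo s x * cnj (expo t x) = expo (s - t) x"
  by (simp add: cnj_expo flip: expo_add_left)

lemma expo_eq_expo_iff: "expo s x = expo t x \<longleftrightarrow> (s - t) * x \<in> \<int>"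
proof -
  have "expo s x = expo t x \<longleftrightarrow> expo (s - t) x = 1"
  proof
    assume "expo s x = expo t x"
    hence "expo (s - t) x = expo t x * cnj (expo t x)"
      by (metis expo_mult_cnj)
    thus "expo (s - t) x = 1"
      by (simp add: expo_mult_cnj)
  next
    assume "expo (s - t) x = 1"
    hence "expo ((s - t) + t) x = expo t x"
      by (subst expo_add_left) simp
    thus "expo s x = expo t x"
      by simp
  qed
  also have "\<dots> \<longleftrightarrow> (s - t) * x \<in> \<int>"
  proof
    assume "expo (s - t) x = 1"
    hence "cos (2 * pi * (s - t) * x) = 1"
      by (simp add: expo_eq_cis complex_eq_iff)
    then obtain k :: int where "2 * pi * (s - t) * x = of_int k * 2 * pi"
      by (auto simp: cos_one_2pi_int)
    hence "pi * ((s - t) * x) = pi * of_int k"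
      by (simp add: algebra_simps)
    hence "(s - t) * x = of_int k"
      by simp
    thus "(s - t) * x \<in> \<int>"
      by simp
  qed (rule expo_of_int_eq_1)
  finally show ?thesis .
qed

lemma continuous_on_expo [continuous_intros]:
  "continuous_on S f \<Longrightarrow> continuous_on S (\<lambda>x. expo l (f x))"
  unfolding expo_def by (intro continuous_intros)

lemma borel_measurable_expo [measurable]: "expo l \<in> borel_measurable borel"
  by (intro borel_measurable_continuous_onI continuous_intros)

context
  fixes M :: "real measure"
  assumes M: "prob_space M" "sets M = sets borel"
begin

interpretation prob_space M by (rule M)

lemma borel_measurable_expo_M [measurable]: "expo l \<in> borel_measurable M"
  unfolding measurable_cong_sets[OF M(2) refl] by measurable

lemma integrable_expo: "integrable M (expo l)"
  by (rule integrable_const_bound[where B = 1]) auto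

lemma expo_square_integrable: "expo l \<in> square_integrable M"
  by (simp add: square_integrable_def)

lemma L2_norm_expo: "L2_norm M (expo l) = 1"
  by (simp add: L2_norm_def prob_space)

lemma L2_inner_expo: "L2_inner M (expo s) (expo t) = fourier_transform M (s - t)"
  by (simp add: L2_inner_def fourier_transform_def expo_mult_cnj)

lemma fourier_transform_0 [simp]: "fourier_transform M 0 = 1"
  by (simp add: fourier_transform_def prob_space)

lemma cnj_fourier_transform: "cnj (fourier_transform M t) = fourier_transform M (- t)"
  by (simp add: fourier_transform_def cnj_expo flip: Bochner_Integration.integral_cnj)

text \<open>Orthogonality removes the cross terms, and completing the square leaves the distance of
  each \<open>c s\<close> from the Fourier coefficient. For arbitrary \<open>c\<close> this bounds
  the error from below; at the coefficients the error is exactly the Parseval defect.\<close>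

lemma L2_norm_expo_expansion:
  assumes F: "finite F"
    and orth: "\<And>s t. s \<in> F \<Longrightarrow> t \<in> F \<Longrightarrow> s \<noteq> t \<Longrightarrow> fourier_transform M (s - t) = 0"
  shows "(L2_norm M (\<lambda>x. expo \<xi> x - (\<Sum>s\<in>F. c s * expo s x)))\<^sup>2 =
    1 - (\<Sum>s\<in>F. (cmod (fourier_transform M (\<xi> - s)))\<^sup>2)
      + (\<Sum>s\<in>F. (cmod (c s - fourier_transform M (\<xi> - s)))\<^sup>2)"
proof -
  let ?f = "fourier_transform M"
  define g where "g x = expo \<xi> x - (\<Sum>s\<in>F. c s * expo s x)" for x
  have eq: "g x * cnj (g x) = 1 - (\<Sum>s\<in>F. cnj (c s) * expo (\<xi> - s) x) - (\<Sum>s\<in>F. c s * expo (s - \<xi>) x)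
      + (\<Sum>s\<in>F. \<Sum>t\<in>F. c s * cnj (c t) * expo (s - t) x)" for x
  proof -
    define S where "S = (\<Sum>s\<in>F. c s * expo s x)"
    have "g x * cnj (g x) = expo \<xi> x * cnj (expo \<xi> x) - expo \<xi> x * cnj S
        - S * cnj (expo \<xi> x) + S * cnj S"
      by (simp add: g_def S_def [symmetric] algebra_simps)
    also have "expo \<xi> x * cnj (expo \<xi> x) = 1"
      by (simp add: expo_mult_cnj)
    also have "expo \<xi> x * cnj S = (\<Sum>s\<in>F. cnj (c s) * (expo \<xi> x * cnj (expo s x)))"
      by (simp add: S_def sum_distrib_left mult_ac)
    also have "S * cnj (expo \<xi> x) = (\<Sum>s\<in>F. c s * (expo s x * cnj (expo \<xi> x)))"
      by (simp add: S_def sum_distrib_right mult.assoc)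
    also have "S * cnj S = (\<Sum>s\<in>F. \<Sum>t\<in>F. c s * cnj (c t) * (expo s x * cnj (expo t x)))"
      by (simp add: S_def sum_product mult_ac)
    finally show ?thesis
      by (simp only: expo_mult_cnj)
  qed
  have int [simp]: "integrable M (\<lambda>x. a * expo l x)" for a l
    by (intro integrable_mult_right integrable_expo)
  have "of_real ((L2_norm M g)\<^sup>2) = (of_real (\<integral>x. (cmod (g x))\<^sup>2 \<partial>M) :: complex)"
    by (simp add: L2_norm_def)
  also have "\<dots> = (\<integral>x. of_real ((cmod (g x))\<^sup>2) \<partial>M)"
    by (rule integral_complex_of_real [symmetric])
  also have "\<dots> = (\<integral>x. g x * cnj (g x) \<partial>M)"
    by (simp only: complex_norm_square)
  also have "\<dots> = 1 - (\<Sum>s\<in>F. cnj (c s) * ?f (\<xi> - s)) - (\<Sum>s\<in>F. c s * ?f (s - \<xi>))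
      + (\<Sum>s\<in>F. \<Sum>t\<in>F. c s * cnj (c t) * ?f (s - t))"
    unfolding eq fourier_transform_def
    by (simp add: integrable_expo prob_space)
  also have "(\<Sum>s\<in>F. \<Sum>t\<in>F. c s * cnj (c t) * ?f (s - t)) = (\<Sum>s\<in>F. c s * cnj (c s))"
  proof (rule sum.cong[OF refl])
    fix s assume "s \<in> F"
    hence "(\<Sum>t\<in>F. c s * cnj (c t) * ?f (s - t)) = (\<Sum>t\<in>F. if t = s then c s * cnj (c s) else 0)"
      by (intro sum.cong) (use orth in auto)
    thus "(\<Sum>t\<in>F. c s * cnj (c t) * ?f (s - t)) = c s * cnj (c s)"
      using F \<open>s \<in> F\<close> by simp
  qed
  also have "1 - (\<Sum>s\<in>F. cnj (c s) * ?f (\<xi> - s)) - (\<Sum>s\<in>F. c s * ?f (s - \<xi>)) + (\<Sum>s\<in>F. c s * cnj (c s))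
     = 1 - (\<Sum>s\<in>F. ?f (\<xi> - s) * cnj (?f (\<xi> - s)))
       + (\<Sum>s\<in>F. (c s - ?f (\<xi> - s)) * cnj (c s - ?f (\<xi> - s)))"
  proof -
    have "?f (s - \<xi>) = cnj (?f (\<xi> - s))" for s
      by (simp add: cnj_fourier_transform)
    thus ?thesis
      by (simp add: algebra_simps sum.distrib sum_subtractf)
  qed
  also have "\<dots> = of_real (1 - (\<Sum>s\<in>F. (cmod (?f (\<xi> - s)))\<^sup>2)
      + (\<Sum>s\<in>F. (cmod (c s - ?f (\<xi> - s)))\<^sup>2))"
    by (simp only: complex_norm_square of_real_add of_real_diff of_real_sum of_real_1)
  finally show ?thesis
    by (simp only: of_real_eq_iff g_def)
qed

lemma is_spectrum_orthogonal:
  "is_spectrum M \<Lambda> \<Longrightarrow> s \<in> \<Lambda> \<Longrightarrow> t \<in> \<Lambda> \<Longrightarrow> s \<noteq> t \<Longrightarrow> fourier_transform M (s - t) = 0"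
  by (auto simp: is_spectrum_def orthogonal_basis_L2_def L2_inner_expo)

text \<open>One inequality is Bessel's, from the best approximation. For the other, density supplies
  combinations with arbitrarily small error, and by the expansion no error falls below the Parseval
  defect.\<close>

lemma is_spectrum_parseval:
  assumes spec: "is_spectrum M \<Lambda>" and fin: "finite \<Lambda>"
  shows "(\<Sum>s\<in>\<Lambda>. (cmod (fourier_transform M (\<xi> - s)))\<^sup>2) = 1"
proof -
  let ?f = "fourier_transform M"
  have orth: "?f (s - t) = 0" if "s \<in> \<Lambda>" "t \<in> \<Lambda>" "s \<noteq> t" for s t
    using is_spectrum_orthogonal[OF spec that] .
  have "(\<Sum>s\<in>\<Lambda>. (cmod (?f (\<xi> - s)))\<^sup>2) \<le> 1"
  proof -
    have "0 \<le> (L2_norm M (\<lambda>x. expo \<xi> x - (\<Sum>s\<in>\<Lambda>. ?f (\<xi> - s) * expo s x)))\<^sup>2"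
      by simp
    also have "\<dots> = 1 - (\<Sum>s\<in>\<Lambda>. (cmod (?f (\<xi> - s)))\<^sup>2)"
      by (subst L2_norm_expo_expansion[OF fin orth]) auto
    finally show ?thesis
      by simp
  qed
  moreover have "1 \<le> (\<Sum>s\<in>\<Lambda>. (cmod (?f (\<xi> - s)))\<^sup>2) + \<epsilon>" if "\<epsilon> > 0" for \<epsilon>
  proof -
    have "sqrt \<epsilon> > 0" using that by simp
    then obtain F c where F: "finite F" "F \<subseteq> \<Lambda>"
      and le: "L2_norm M (\<lambda>x. expo \<xi> x - (\<Sum>s\<in>F. c s * expo s x)) < sqrt \<epsilon>"
      using spec expo_square_integrable[of \<xi>]
      unfolding is_spectrum_def orthogonal_basis_L2_def by meson
    have "(L2_norm M (\<lambda>x. expo \<xi> x - (\<Sum>s\<in>F. c s * expo s x)))\<^sup>2 < (sqrt \<epsilon>)\<^sup>2"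
      by (rule power_strict_mono[OF le]) (auto simp: L2_norm_def)
    moreover have "(L2_norm M (\<lambda>x. expo \<xi> x - (\<Sum>s\<in>F. c s * expo s x)))\<^sup>2 \<ge>
        1 - (\<Sum>s\<in>F. (cmod (?f (\<xi> - s)))\<^sup>2)"
      by (subst L2_norm_expo_expansion[OF F(1)]) (use F orth in \<open>auto intro!: sum_nonneg\<close>)
    moreover have "(\<Sum>s\<in>F. (cmod (?f (\<xi> - s)))\<^sup>2) \<le> (\<Sum>s\<in>\<Lambda>. (cmod (?f (\<xi> - s)))\<^sup>2)"
      by (rule sum_mono2) (use F fin in auto)
    ultimately show ?thesis
      using that by simp
  qed
  ultimately show ?thesis
    by (meson antisym field_le_epsilon)
qed

end

section \<open>Uniform measures on finite sets of integers and their masks\<close>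

lemma uniform_dirac_eq_distr:
  assumes "finite C" "C \<noteq> {}"
  shows "uniform_dirac C = distr (measure_pmf (pmf_of_set C)) borel (\<lambda>x. x)"
proof (rule measure_eqI)
  fix X assume "X \<in> sets (uniform_dirac C)"
  hence X: "X \<in> sets borel" by simp
  have "(\<Sum>c\<in>C. emeasure (return borel c) X) = of_nat (card (C \<inter> X))"
    using X assms by (simp add: indicator_def sum.If_cases Int_def)
  hence "emeasure (uniform_dirac C) X = inverse (of_nat (card C)) * of_nat (card (C \<inter> X))"
    using X by (simp add: emeasure_uniform_dirac divide_ennreal_def)
  also have "\<dots> = ennreal (real (card (C \<inter> X)) / real (card C))"
    using assms
    by (simp add: ennreal_of_nat_eq_real_of_nat inverse_ennreal card_gt_0_iff divide_inverse
        mult.commute flip: ennreal_mult')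
  finally show "emeasure (uniform_dirac C) X =
      emeasure (distr (measure_pmf (pmf_of_set C)) borel (\<lambda>x. x)) X"
    using X assms by (simp add: emeasure_distr emeasure_pmf_of_set)
qed simp

lemma fourier_transform_uniform_dirac:
  assumes "finite C" "C \<noteq> {}"
  shows "fourier_transform (uniform_dirac C) t = (\<Sum>c\<in>C. expo t c) / of_nat (card C)"
proof -
  have "fourier_transform (uniform_dirac C) t = (\<integral>x. expo t x \<partial>measure_pmf (pmf_of_set C))"
    unfolding fourier_transform_def uniform_dirac_eq_distr[OF assms]
    by (rule integral_distr) auto
  also have "\<dots> = (\<Sum>c\<in>C. pmf (pmf_of_set C) c *\<^sub>R expo t c)"
    by (rule integral_measure_pmf) (use assms in auto)
  also have "\<dots> = (\<Sum>c\<in>C. expo t c) / of_nat (card C)"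
    using assms by (simp add: scaleR_conv_of_real sum_divide_distrib)
  finally show ?thesis .
qed

lemma prob_space_uniform_dirac: "finite C \<Longrightarrow> C \<noteq> {} \<Longrightarrow> prob_space (uniform_dirac C)"
  unfolding uniform_dirac_eq_distr
  by (rule prob_space.prob_space_distr) (auto simp: measure_pmf.prob_space_axioms)

lemma fourier_transform_uniform_dirac_int:
  assumes "finite C" "C \<noteq> {}"
  shows "fourier_transform (uniform_dirac (real_of_int ` C)) t = trig_mean C t"
  using assms
  by (simp add: fourier_transform_uniform_dirac trig_mean_def sum.reindex card_image expo_commute
      inj_on_def)

lemma trig_mean_add_int: "trig_mean C (x + of_int k) = trig_mean C x"
  by (simp add: trig_mean_def expo_add_right expo_of_int_eq_1)

lemma trig_mean_minus: "trig_mean C (- x) = cnj (trig_mean C x)"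
  by (simp add: trig_mean_def cnj_expo) (simp add: expo_eq_cis)

lemma trig_mean_0 [simp]: "finite C \<Longrightarrow> C \<noteq> {} \<Longrightarrow> trig_mean C 0 = 1"
  by (simp add: trig_mean_def)

lemma norm_trig_mean_le_1: "cmod (trig_mean C x) \<le> 1"
proof -
  have "cmod (\<Sum>c\<in>C. expo (of_int c) x) \<le> (\<Sum>c\<in>C. cmod (expo (of_int c) x))"
    by (rule norm_sum)
  thus ?thesis
    by (cases "card C = 0") (simp_all add: trig_mean_def norm_divide divide_simps)
qed

lemma set_has_spectrum_trig_mean:
  fixes C L :: "int set" and a :: int
  assumes spec: "set_has_spectrum (real_of_int ` C) ((\<lambda>l. 1 / real_of_int a * real_of_int l) ` L)"
    and a: "a > 0"
  shows "finite C" "C \<noteq> {}" "finite L" "(\<Sum>l\<in>L. (cmod (trig_mean C (x + of_int l / of_int a)))\<^sup>2) = 1"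
proof -
  define h where "h = (\<lambda>l. 1 / real_of_int a * real_of_int l)"
  have sp: "is_spectrum (uniform_dirac (real_of_int ` C)) (h ` L)"
    using spec by (simp add: set_has_spectrum_def h_def)
  show C: "finite C" "C \<noteq> {}"
    using spec by (auto simp: set_has_spectrum_def inj_on_def dest: finite_imageD)
  have M: "prob_space (uniform_dirac (real_of_int ` C))"
    using C by (simp add: prob_space_uniform_dirac)
  \<comment> \<open>Frequencies l/a and l'/a with l congruent to l' modulo \<open>a\<close> give the
    same function on integer digits, and a unit vector is not orthogonal to itself. Hence
    \<open>L\<close> has at most \<open>a\<close> elements.\<close>
  have "inj_on (\<lambda>l. l mod a) L"
  proof (rule inj_onI, rule ccontr)
    fix l l' assume l: "l \<in> L" "l' \<in> L" "l mod a = l' mod a" "l \<noteq> l'"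
    then obtain k where k: "l - l' = a * k"
      by (metis mod_eq_dvd_iff dvdE)
    have "trig_mean C (h l - h l') = 0"
      using is_spectrum_orthogonal[OF M _ sp, of "h l" "h l'"] l a
      by (auto simp: fourier_transform_uniform_dirac_int[OF C] h_def)
    moreover have "h l - h l' = 0 + of_int k"
      using arg_cong[OF k, of real_of_int] a by (simp add: h_def field_simps)
    ultimately show False
      using trig_mean_add_int[of C 0 k] C by simp
  qed
  moreover have "(\<lambda>l. l mod a) ` L \<subseteq> {0..<a}"
    using a by auto
  ultimately show L: "finite L"
    by (meson finite_atLeastLessThan_int finite_imageD finite_subset)
  have inj: "inj_on h L"
    using a by (auto simp: inj_on_def h_def)
  have "1 = (\<Sum>l\<in>L. (cmod (trig_mean C (- (x + h l))))\<^sup>2)"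
    using is_spectrum_parseval[OF M _ sp, of "- x"] L
    by (simp add: sum.reindex[OF inj] fourier_transform_uniform_dirac_int[OF C] algebra_simps)
  thus "(\<Sum>l\<in>L. (cmod (trig_mean C (x + of_int l / of_int a)))\<^sup>2) = 1"
    by (simp only: trig_mean_minus complex_mod_cnj) (simp add: h_def)
qed

subsection \<open>Refinement equations and the construction of the spectrum\<close>

text \<open>At x = - T j the index \<open>j\<close> contributes the square of V 0, which already
  exhausts the sum, so every other term vanishes. Orthogonality and, below, injectivity of
  \<open>T\<close> are thus recovered from Parseval alone.\<close>

lemma parseval_orthogonal:
  fixes V :: "real \<Rightarrow> real"
  assumes I: "finite I" and V0: "V 0 = 1" and sum: "\<And>x. (\<Sum>i\<in>I. (V (x + T i))\<^sup>2) = 1"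
    and ij: "i \<in> I" "j \<in> I" "i \<noteq> j"
  shows "V (T i - T j) = 0"
proof -
  have "(\<Sum>k\<in>{j, i}. (V (- T j + T k))\<^sup>2) \<le> (\<Sum>k\<in>I. (V (- T j + T k))\<^sup>2)"
    by (rule sum_mono2) (use I ij in auto)
  also have "\<dots> = 1" by (rule sum)
  finally show ?thesis
    using ij V0 by simp
qed

lemma parseval_inj_on:
  fixes V :: "real \<Rightarrow> real"
  assumes I: "finite I" and V0: "V 0 = 1" and sum: "\<And>x. (\<Sum>i\<in>I. (V (x + T i))\<^sup>2) = 1"
  shows "inj_on T I"
  using parseval_orthogonal[OF I V0 sum] V0 by (force intro!: inj_onI)

lemma parseval_image:
  fixes V :: "real \<Rightarrow> real"
  assumes "finite I" "V 0 = 1" "\<And>x. (\<Sum>i\<in>I. (V (x + T i))\<^sup>2) = 1"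
  shows "(\<Sum>s\<in>T ` I. (V (x + s))\<^sup>2) = 1"
  using assms(3) by (simp add: sum.reindex[OF parseval_inj_on[OF assms]])

text \<open>Dividing \<open>x\<close> by \<open>A\<close> cannot decrease the distance between the
  two solutions, as the mask has norm at most 1; the iterates tend to 0, where the distance vanishes
  by continuity. This serves twice: for uniqueness of the invariant measure and for factoring the
  modulus of its transform.\<close>

lemma refinement_equation_unique:
  fixes f g m :: "real \<Rightarrow> 'b :: real_normed_algebra" and A :: real
  assumes A: "A > 1" and m: "\<And>x. norm (m x) \<le> 1"
    and f: "\<And>x. f x = m (x / A) * f (x / A)" and g: "\<And>x. g x = m (x / A) * g (x / A)"
    and cont: "isCont f 0" "isCont g 0" and eq: "f 0 = g 0"
  shows "f x = g x"
proof -
  have le: "norm (f x - g x) \<le> norm (f (x / A ^ n) - g (x / A ^ n))" for n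
  proof (induction n)
    case (Suc n)
    let ?y = "x / A ^ n"
    have "norm (f ?y - g ?y) = norm (m (?y / A) * (f (?y / A) - g (?y / A)))"
      by (subst f, subst g) (simp add: right_diff_distrib)
    also have "\<dots> \<le> norm (m (?y / A)) * norm (f (?y / A) - g (?y / A))"
      by (rule norm_mult_ineq)
    also have "\<dots> \<le> 1 * norm (f (?y / A) - g (?y / A))"
      by (intro mult_right_mono m) auto
    finally show ?case
      using Suc by (simp add: mult.commute)
  qed simp
  have "(\<lambda>n. x / A ^ n) \<longlonglongrightarrow> 0"
    by (rule LIMSEQ_divide_realpow_zero[OF A])
  hence "(\<lambda>n. norm (f (x / A ^ n) - g (x / A ^ n))) \<longlonglongrightarrow> norm (f 0 - g 0)"
    by (intro tendsto_intros isCont_tendsto_compose[OF cont(1)] isCont_tendsto_compose[OF cont(2)])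
  hence "norm (f x - g x) \<le> norm (f 0 - g 0)"
    by (rule LIMSEQ_le_const) (use le in auto)
  thus ?thesis
    using eq by simp
qed

section \<open>Infinite products of a periodic low-pass filter\<close>

locale low_pass_filter =
  fixes A :: int and w :: "real \<Rightarrow> real" and K :: real
  assumes A_ge_2: "A \<ge> 2"
    and nonneg: "0 \<le> w x" and le_1: "w x \<le> 1" and at_0: "w 0 = 1"
    and periodic: "w (x + of_int k) = w x"
    and lipschitz: "\<bar>w x - w y\<bar> \<le> K * \<bar>x - y\<bar>"
begin

lemma A_gt [simp]: "real_of_int A > 1" "real_of_int A > 0" "A \<noteq> 0" "A > 0"
  using A_ge_2 by auto

lemma K_nonneg: "K \<ge> 0"
  using lipschitz[of 1 0] abs_ge_zero[of "w 1 - w 0"] by simp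

definition partial_product :: "nat \<Rightarrow> real \<Rightarrow> real" where
  "partial_product n x = (\<Prod>j<n. w (x / of_int A ^ Suc j))"

definition phi :: "real \<Rightarrow> real" where
  "phi x = lim (\<lambda>n. partial_product n x)"

lemma partial_product_nonneg: "0 \<le> partial_product n x"
  and partial_product_le_1: "partial_product n x \<le> 1"
  and partial_product_at_0: "partial_product n 0 = 1"
  by (auto simp: partial_product_def nonneg le_1 at_0 intro!: prod_nonneg prod_le_1)

lemma partial_product_add:
  "partial_product (n + m) x = partial_product n x * partial_product m (x / of_int A ^ n)"
proof (induction m)
  case (Suc m)
  have "w (x / of_int A ^ Suc (n + m)) = w (x / of_int A ^ n / of_int A ^ Suc m)"
    by (simp add: power_add mult_ac)
  thus ?case
    using Suc by (simp add: partial_product_def)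
qed (simp add: partial_product_def)

lemma partial_product_decseq: "decseq (\<lambda>n. partial_product n x)"
proof (rule decseq_SucI)
  fix n
  show "partial_product (Suc n) x \<le> partial_product n x"
    using mult_left_le[OF le_1[of "x / of_int A ^ Suc n"] partial_product_nonneg[of n x]]
    by (simp add: partial_product_def)
qed

lemma partial_product_tendsto: "(\<lambda>n. partial_product n x) \<longlonglongrightarrow> phi x"
proof -
  have "convergent (\<lambda>n. partial_product n x)"
    by (rule decseq_convergent[OF partial_product_decseq, of 0])
       (auto simp: partial_product_nonneg convergent_def)
  thus ?thesis
    by (simp add: phi_def convergent_LIMSEQ_iff)
qed

lemma phi_nonneg: "0 \<le> phi x"
  by (rule LIMSEQ_le_const[OF partial_product_tendsto]) (auto simp: partial_product_nonneg)

lemma phi_le_1: "phi x \<le> 1"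
  by (rule LIMSEQ_le_const2[OF partial_product_tendsto]) (auto simp: partial_product_le_1)

lemma phi_at_0: "phi 0 = 1"
  using partial_product_tendsto[of 0] by (simp add: partial_product_at_0 LIMSEQ_const_iff)

lemma phi_split: "phi x = partial_product n x * phi (x / of_int A ^ n)"
proof (rule LIMSEQ_unique)
  show "(\<lambda>m. partial_product (n + m) x) \<longlonglongrightarrow> phi x"
    using LIMSEQ_ignore_initial_segment[OF partial_product_tendsto[of x], of n]
    by (simp add: add.commute)
  show "(\<lambda>m. partial_product (n + m) x) \<longlonglongrightarrow> partial_product n x * phi (x / of_int A ^ n)"
    unfolding partial_product_add by (intro tendsto_intros partial_product_tendsto)
qed

lemma phi_refinement: "phi x = w (x / of_int A) * phi (x / of_int A)"
  using phi_split[of x 1] by (simp add: partial_product_def)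

text \<open>The difference of two products with factors in [0,1] is at most the sum of the
  differences of the factors. Since \<open>A\<close> is at least 2, the factor at index
  \<open>j\<close> contributes at most K * |x - y| / 2 ^ Suc j, and these weights sum to less than
  1, so the constant of \<open>w\<close> survives.\<close>

lemma phi_lipschitz: "\<bar>phi x - phi y\<bar> \<le> K * \<bar>x - y\<bar>"
proof -
  have "\<bar>partial_product n x - partial_product n y\<bar> \<le> K * \<bar>x - y\<bar>" for n
  proof -
    have "\<bar>partial_product n x - partial_product n y\<bar>
        \<le> (\<Sum>j<n. \<bar>w (x / of_int A ^ Suc j) - w (y / of_int A ^ Suc j)\<bar>)"
      unfolding partial_product_def
      using norm_prod_diff[of "{..<n}" "\<lambda>j. w (x / of_int A ^ Suc j)" "\<lambda>j. w (y / of_int A ^ Suc j)"]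
      by (simp add: nonneg le_1 abs_of_nonneg)
    also have "\<dots> \<le> (\<Sum>j<n. K * \<bar>x - y\<bar> * (1/2) ^ Suc j)"
    proof (rule sum_mono)
      fix j
      have "2 ^ Suc j \<le> real_of_int A ^ Suc j"
        using A_ge_2 by (intro power_mono) auto
      hence "\<bar>x - y\<bar> / real_of_int A ^ Suc j \<le> \<bar>x - y\<bar> / 2 ^ Suc j"
        by (intro divide_left_mono mult_pos_pos zero_less_power) auto
      hence "K * (\<bar>x - y\<bar> / real_of_int A ^ Suc j) \<le> K * (\<bar>x - y\<bar> / 2 ^ Suc j)"
        by (rule mult_left_mono[OF _ K_nonneg])
      moreover have "\<bar>w (x / of_int A ^ Suc j) - w (y / of_int A ^ Suc j)\<bar>
          \<le> K * \<bar>x / of_int A ^ Suc j - y / of_int A ^ Suc j\<bar>"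
        by (rule lipschitz)
      moreover have "\<bar>x / of_int A ^ Suc j - y / of_int A ^ Suc j\<bar> = \<bar>x - y\<bar> / of_int A ^ Suc j"
          by (subst diff_divide_distrib [symmetric])
             (simp only: abs_divide abs_of_pos[OF zero_less_power[OF A_gt(2)]])
      ultimately show "\<bar>w (x / of_int A ^ Suc j) - w (y / of_int A ^ Suc j)\<bar>
          \<le> K * \<bar>x - y\<bar> * (1/2) ^ Suc j"
        by (simp add: power_divide)
    qed
    also have "\<dots> = K * \<bar>x - y\<bar> * (\<Sum>j<n. (1/2) ^ Suc j)"
      by (simp add: sum_distrib_left)
    also have "\<dots> \<le> K * \<bar>x - y\<bar> * 1"
    proof (rule mult_left_mono)
      have "(\<Sum>j<n. (1/2::real) ^ Suc j) = 1 - (1/2) ^ n"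
        by (induction n) auto
      thus "(\<Sum>j<n. (1/2::real) ^ Suc j) \<le> 1" by simp
    qed (use K_nonneg in auto)
    finally show ?thesis by simp
  qed
  moreover have "(\<lambda>n. \<bar>partial_product n x - partial_product n y\<bar>) \<longlonglongrightarrow> \<bar>phi x - phi y\<bar>"
    by (intro tendsto_intros partial_product_tendsto)
  ultimately show ?thesis
    by (intro LIMSEQ_le_const2) auto
qed

lemma isCont_phi: "isCont phi x"
proof -
  have lim: "((\<lambda>y. K * \<bar>y - x\<bar>) \<longlongrightarrow> 0) (at x)"
    by (auto intro!: tendsto_eq_intros)
  have "((\<lambda>y. phi y - phi x) \<longlongrightarrow> 0) (at x)"
    by (rule Lim_null_comparison[OF _ lim]) (simp add: phi_lipschitz)
  thus ?thesis
    by (simp add: isCont_def LIM_zero_iff)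
qed

lemma phi_le_phi_div: "phi x \<le> phi (x / of_int A)"
  using mult_right_mono[OF le_1 phi_nonneg, of "x / of_int A" "x / of_int A"] phi_refinement[of x]
  by simp

lemma partial_product_periodic:
  "partial_product n (x + of_int A ^ n * of_int k) = partial_product n x"
  unfolding partial_product_def
proof (rule prod.cong[OF refl])
  fix j assume "j \<in> {..<n}"
  hence "of_int A ^ n = (of_int A ^ (n - Suc j) * of_int A ^ Suc j :: real)"
    by (subst power_add[symmetric]) simp
  hence "(x + of_int A ^ n * of_int k) / of_int A ^ Suc j =
      x / of_int A ^ Suc j + of_int (A ^ (n - Suc j) * k)"
    by (simp add: add_divide_distrib)
  thus "w ((x + of_int A ^ n * of_int k) / of_int A ^ Suc j) = w (x / of_int A ^ Suc j)"
    by (simp only: periodic)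
qed

end

text \<open>
  The factor \<open>W\<close> collects the finitely many factors of the transform of the measure that are
  not contracted; translating by integers does not affect it, which leaves room for moving the
  points of the candidate spectrum to places where \<open>phi\<close> is bounded below.
\<close>

locale spectral_construction = low_pass_filter +
  fixes L :: "int set" and W :: "real \<Rightarrow> real" and \<Gamma> :: "real set" and \<epsilon> :: real
  assumes fin_L: "finite L" and zero_in_L: "0 \<in> L"
    and sum_L: "(\<Sum>l\<in>L. (w (x + of_int l / of_int A))\<^sup>2) = 1"
    and W_nonneg: "0 \<le> W x" and W_le_1: "W x \<le> 1" and W_at_0: "W 0 = 1"
    and W_periodic: "W (x + of_int k) = W x"
    and fin_Gamma: "finite \<Gamma>" and sum_Gamma: "(\<Sum>g\<in>\<Gamma>. (W (x + g))\<^sup>2) = 1"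
    and eps_pos: "\<epsilon> > 0" and equi_positive: "\<exists>k::int. phi (x + of_int k) \<ge> \<epsilon>"
begin

text \<open>The value 0 takes precedence over the arbitrary choice, so that a point which is already
  good stays put; the nesting of the levels rests on this.\<close>

definition shift :: "real \<Rightarrow> int" where
  "shift x = (if phi x \<ge> \<epsilon> then 0 else SOME k. phi (x + of_int k) \<ge> \<epsilon>)"

lemma phi_shift: "phi (x + of_int (shift x)) \<ge> \<epsilon>"
  using someI_ex[OF equi_positive[of x]] by (auto simp: shift_def)

text \<open>The usual digit step s + A^n l, followed by a multiple of A^(n+1). That multiple is a
  period of the partial product of length n + 1, and after division by A^(n+1) it is the integer
  that brings \<open>phi\<close> up to at least \<epsilon>.\<close>

definition next_point :: "nat \<Rightarrow> real \<times> int \<Rightarrow> real" where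
  "next_point n = (\<lambda>(s, l). s + of_int A ^ n * of_int l
     + of_int A ^ Suc n * of_int (shift ((s + of_int A ^ n * of_int l) / of_int A ^ Suc n)))"

primrec level :: "nat \<Rightarrow> real set" where
  "level 0 = (\<lambda>g. g + of_int (shift g)) ` \<Gamma>"
| "level (Suc n) = next_point n ` (level n \<times> L)"

definition level_transform :: "nat \<Rightarrow> real \<Rightarrow> real" where
  "level_transform n x = W x * partial_product n x"

definition transform :: "real \<Rightarrow> real" where
  "transform x = W x * phi x"

lemma transform_split: "transform x = level_transform n x * phi (x / of_int A ^ n)"
  by (simp add: transform_def level_transform_def mult.assoc flip: phi_split)

lemma level_transform_nonneg: "0 \<le> level_transform n x"
  by (simp add: level_transform_def W_nonneg partial_product_nonneg)

lemma transform_nonneg: "0 \<le> transform x"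
  by (simp add: transform_def W_nonneg phi_nonneg)

lemma transform_le_level_transform: "transform x \<le> level_transform n x"
  unfolding transform_split[of x n] by (intro mult_left_le phi_le_1 level_transform_nonneg)

lemma level_transform_at_0: "level_transform n 0 = 1"
  by (simp add: level_transform_def W_at_0 partial_product_at_0)

lemma finite_level: "finite (level n)"
  by (induction n) (auto simp: fin_L fin_Gamma)

lemma level_transform_periodic:
  "level_transform n (x + of_int A ^ n * of_int k) = level_transform n x"
  using W_periodic[of x "A ^ n * k"] by (simp add: level_transform_def partial_product_periodic)

lemma level_transform_Suc:
  "level_transform (Suc n) x = level_transform n x * w (x / of_int A ^ Suc n)"
  by (simp add: level_transform_def partial_product_def)

text \<open>The new point differs from the old one by a multiple of A^n, a period of every factor
  but the last. The sum therefore splits: over \<open>L\<close> the last factor gives 1 by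
  \<open>sum_L\<close>, and what remains is the sum for the previous level.\<close>

lemma level_parseval: "(\<Sum>s\<in>level n. (level_transform n (x + s))\<^sup>2) = 1"
proof (induction n arbitrary: x)
  case 0
  have "(\<Sum>g\<in>\<Gamma>. (W (x + (g + of_int (shift g))))\<^sup>2) = 1" for x
    by (simp only: add.assoc[symmetric] W_periodic sum_Gamma)
  from parseval_image[where V = W, OF fin_Gamma W_at_0 this] show ?case
    by (simp add: level_transform_def partial_product_def)
next
  case (Suc n)
  have *: "level_transform (Suc n) (x + next_point n (s, l)) =
      level_transform n (x + s) * w ((x + s) / of_int A ^ Suc n + of_int l / of_int A)" for x s l
  proof -
    let ?k = "shift ((s + of_int A ^ n * of_int l) / of_int A ^ Suc n)"
    have "x + next_point n (s, l) = (x + s) + of_int A ^ n * of_int (l + A * ?k)"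
      by (simp add: next_point_def algebra_simps)
    hence "level_transform n (x + next_point n (s, l)) = level_transform n (x + s)"
      by (simp only: level_transform_periodic)
    moreover have "(x + next_point n (s, l)) / of_int A ^ Suc n =
        (x + s) / of_int A ^ Suc n + of_int l / of_int A + of_int ?k"
      by (simp add: next_point_def add_divide_distrib)
    hence "w ((x + next_point n (s, l)) / of_int A ^ Suc n) =
        w ((x + s) / of_int A ^ Suc n + of_int l / of_int A)"
      by (simp only: periodic)
    ultimately show ?thesis
      by (simp only: level_transform_Suc)
  qed
  have "(\<Sum>q\<in>level n \<times> L. (level_transform (Suc n) (x + next_point n q))\<^sup>2) = 1" for x
  proof -
    have "(\<Sum>q\<in>level n \<times> L. (level_transform (Suc n) (x + next_point n q))\<^sup>2) =
      (\<Sum>s\<in>level n. \<Sum>l\<in>L. (level_transform (Suc n) (x + next_point n (s, l)))\<^sup>2)"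
      by (simp add: sum.cartesian_product)
    also have "\<dots> = (\<Sum>s\<in>level n. (level_transform n (x + s))\<^sup>2 *
        (\<Sum>l\<in>L. (w ((x + s) / of_int A ^ Suc n + of_int l / of_int A))\<^sup>2))"
      by (simp only: * power_mult_distrib sum_distrib_left)
    also have "\<dots> = 1"
      by (simp only: sum_L mult_1_right Suc.IH)
    finally show ?thesis .
  qed
  from parseval_image[where V = "level_transform (Suc n)", OF _ level_transform_at_0 this]
  show ?case
    by (simp add: finite_level fin_L)
qed

lemma phi_level: "s \<in> level n \<Longrightarrow> phi (s / of_int A ^ n) \<ge> \<epsilon>"
proof (cases n)
  case (Suc m)
  assume "s \<in> level n"
  then obtain t l where "s = next_point m (t, l)"
    using Suc by auto
  hence "s / of_int A ^ n = (t + of_int A ^ m * of_int l) / of_int A ^ Suc m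
      + of_int (shift ((t + of_int A ^ m * of_int l) / of_int A ^ Suc m))"
    by (simp add: Suc next_point_def add_divide_distrib)
  thus ?thesis
    using phi_shift by simp
qed (auto simp: phi_shift)

text \<open>The digit 0 keeps \<open>s\<close>: passing from s / A^n to s / A^(n+1) can only
  increase \<open>phi\<close>, so \<open>shift\<close> returns 0.\<close>

lemma level_subset_Suc: "level n \<subseteq> level (Suc n)"
proof
  fix s assume s: "s \<in> level n"
  have "\<epsilon> \<le> phi (s / of_int A ^ Suc n)"
    using phi_level[OF s] phi_le_phi_div[of "s / of_int A ^ n"] by (simp add: mult.commute)
  hence "next_point n (s, 0) = s"
    by (simp add: next_point_def shift_def)
  thus "s \<in> level (Suc n)"
    using s zero_in_L by (auto intro!: image_eqI[of _ _ "(s, 0)"])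
qed

lemma level_mono: "m \<le> n \<Longrightarrow> level m \<subseteq> level n"
  by (rule lift_Suc_mono_le[of level, OF level_subset_Suc])

definition points :: "real set" where
  "points = (\<Union>n. level n)"

lemma finite_subset_points: "finite F \<Longrightarrow> F \<subseteq> points \<Longrightarrow> \<exists>n. F \<subseteq> level n"
proof (induction F rule: finite_induct)
  case (insert s F)
  then obtain n m where "F \<subseteq> level n" "s \<in> level m"
    by (auto simp: points_def)
  thus ?case
    using level_mono[of n "max n m"] level_mono[of m "max n m"] by (intro exI[of _ "max n m"]) auto
qed auto

lemma points_orthogonal:
  assumes "s \<in> points" "t \<in> points" "s \<noteq> t"
  shows "transform (s - t) = 0"
proof -
  obtain n where "{s, t} \<subseteq> level n"
    using finite_subset_points[of "{s, t}"] assms by auto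
  hence "level_transform n (s - t) = 0"
    using parseval_orthogonal[of "level n" "level_transform n" "\<lambda>s. s"] assms
    by (auto simp: finite_level level_transform_at_0 level_parseval)
  thus ?thesis
    by (simp add: transform_split[of _ n])
qed

lemma points_bessel:
  assumes F: "finite F" "F \<subseteq> points"
  shows "(\<Sum>s\<in>F. (transform (x + s))\<^sup>2) \<le> 1"
proof -
  obtain n where n: "F \<subseteq> level n"
    using finite_subset_points[OF F] by auto
  have "(\<Sum>s\<in>F. (transform (x + s))\<^sup>2) \<le> (\<Sum>s\<in>level n. (transform (x + s))\<^sup>2)"
    by (rule sum_mono2) (use n finite_level in auto)
  also have "\<dots> \<le> (\<Sum>s\<in>level n. (level_transform n (x + s))\<^sup>2)"
    by (intro sum_mono power_mono transform_le_level_transform transform_nonneg)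
  finally show ?thesis
    by (simp add: level_parseval)
qed

text \<open>
  On \<open>level n\<close> the tail factor \<open>phi\<close> is bounded below, so the level sums
  \<open>(level_transform n)\<^sup>2\<close> are dominated by the convergent sum of \<open>transform\<^sup>2\<close>: no mass is lost
  in the limit.
\<close>

lemma points_complete:
  assumes \<eta>: "\<eta> > 0"
  shows "\<exists>F. finite F \<and> F \<subseteq> points \<and> (\<Sum>s\<in>F. (transform (x + s))\<^sup>2) > 1 - \<eta>"
proof -
  define S where "S n = (\<Sum>s\<in>level n. (transform (x + s))\<^sup>2)" for n
  have le1: "S n \<le> 1" for n
    unfolding S_def by (intro points_bessel finite_level) (auto simp: points_def)
  have mono: "S m \<le> S n" if "m \<le> n" for m n
    unfolding S_def using level_mono[OF that] finite_level by (intro sum_mono2) auto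
  have "convergent S"
    by (rule Bseq_monoseq_convergent)
       (auto intro!: BseqI'[of _ 1] monoI1 simp: le1 mono S_def abs_of_nonneg sum_nonneg
          le1[unfolded S_def] mono[unfolded S_def])
  hence "Cauchy S"
    by (rule convergent_Cauchy)
  \<comment> \<open>Dominating the level sums by the limit sums, with the tail at least \<epsilon> /
    2, costs a factor 4 / \<epsilon>^2; this tolerance leaves at most \<eta> / 2 for the points
    added after level \<open>m\<close>.\<close>
  moreover have e: "\<epsilon>\<^sup>2 * \<eta> / 8 > 0"
    using eps_pos \<eta> by simp
  ultimately obtain m where m: "\<And>n. n \<ge> m \<Longrightarrow> S n - S m < \<epsilon>\<^sup>2 * \<eta> / 8"
    unfolding Cauchy_def dist_real_def by (meson abs_less_iff le_refl)
  have small: "eventually (\<lambda>n. K * \<bar>x / of_int A ^ n\<bar> < \<epsilon> / 2) sequentially"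
  proof (rule order_tendstoD(2))
    have "(\<lambda>n. x / of_int A ^ n) \<longlonglongrightarrow> 0"
      by (rule LIMSEQ_divide_realpow_zero[OF A_gt(1)])
    hence "(\<lambda>n. K * \<bar>x / of_int A ^ n\<bar>) \<longlonglongrightarrow> K * \<bar>0\<bar>"
      by (intro tendsto_intros)
    thus "(\<lambda>n. K * \<bar>x / of_int A ^ n\<bar>) \<longlonglongrightarrow> 0" by simp
  qed (use eps_pos in simp)
  have ev: "eventually (\<lambda>n. (\<Sum>s\<in>level m. (level_transform n (x + s))\<^sup>2) \<ge> 1 - \<eta> / 2) sequentially"
    using small eventually_ge_at_top[of m]
  proof eventually_elim
    case (elim n)
    have dom: "(level_transform n (x + s))\<^sup>2 \<le> 4 / \<epsilon>\<^sup>2 * (transform (x + s))\<^sup>2" if "s \<in> level n" for s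
    proof -
      have "\<bar>phi (s / of_int A ^ n) - phi ((x + s) / of_int A ^ n)\<bar>
          \<le> K * \<bar>s / of_int A ^ n - (x + s) / of_int A ^ n\<bar>"
        by (rule phi_lipschitz)
      also have "\<bar>s / of_int A ^ n - (x + s) / of_int A ^ n\<bar> = \<bar>x / of_int A ^ n\<bar>"
        by (simp add: add_divide_distrib)
      finally have "phi ((x + s) / of_int A ^ n) \<ge> \<epsilon> / 2"
        using phi_level[OF that] elim by linarith
      hence "(level_transform n (x + s) * (\<epsilon> / 2))\<^sup>2 \<le> (transform (x + s))\<^sup>2"
        unfolding transform_split[of _ n] using eps_pos
        by (intro power_mono mult_left_mono) (auto simp: level_transform_nonneg)
      thus ?thesis
        using eps_pos by (simp add: field_simps)
    qed
    have sub: "level m \<subseteq> level n"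
      using elim by (intro level_mono)
    have "(\<Sum>s\<in>level n - level m. (level_transform n (x + s))\<^sup>2)
        \<le> 4 / \<epsilon>\<^sup>2 * (\<Sum>s\<in>level n - level m. (transform (x + s))\<^sup>2)"
      unfolding sum_distrib_left by (intro sum_mono dom) auto
    also have "(\<Sum>s\<in>level n - level m. (transform (x + s))\<^sup>2) = S n - S m"
      unfolding S_def by (rule sum_diff[OF finite_level sub])
    also have "4 / \<epsilon>\<^sup>2 * (S n - S m) \<le> 4 / \<epsilon>\<^sup>2 * (\<epsilon>\<^sup>2 * \<eta> / 8)"
      using m[OF elim(2)] by (intro mult_left_mono) auto
    also have "\<dots> = \<eta> / 2"
      using eps_pos by simp
    finally have "(\<Sum>s\<in>level n - level m. (level_transform n (x + s))\<^sup>2) \<le> \<eta> / 2" .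
    moreover have "(\<Sum>s\<in>level n - level m. (level_transform n (x + s))\<^sup>2)
        = 1 - (\<Sum>s\<in>level m. (level_transform n (x + s))\<^sup>2)"
      by (simp add: sum_diff[OF finite_level sub] level_parseval)
    ultimately show ?case by linarith
  qed
  \<comment> \<open>With \<open>m\<close> fixed the sum is finite, so letting \<open>n\<close> grow
    replaces the partial products by \<open>phi\<close> term by term.\<close>
  have "(\<lambda>n. \<Sum>s\<in>level m. (level_transform n (x + s))\<^sup>2) \<longlonglongrightarrow> S m"
    unfolding S_def level_transform_def transform_def
    by (intro tendsto_intros partial_product_tendsto)
  hence "1 - \<eta> / 2 \<le> S m"
    using ev by (rule tendsto_lowerbound) simp
  hence "S m > 1 - \<eta>"
    using \<eta> by simp
  thus ?thesis
    using finite_level[of m] by (intro exI[of _ "level m"]) (auto simp: S_def points_def)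
qed

end

subsection \<open>Periodic zeros\<close>

locale compatible_filter = low_pass_filter +
  fixes L :: "int set"
  assumes fin_L: "finite L"
    and sum_L: "(\<Sum>l\<in>L. (w (x + of_int l / of_int A))\<^sup>2) = 1"
    and fin_zeros: "finite {x \<in> {0..<1}. w x = 0}"
begin

definition periodic_zeros :: "real set" where
  "periodic_zeros = {x \<in> {0..<1}. \<forall>k::int. phi (x + of_int k) = 0}"

text \<open>Once K / A^r < 1, \<open>phi\<close> is nonzero at x / A^r for all x in [0,1). A zero of
  \<open>phi\<close> there must come from one of the first \<open>r\<close> factors, and each of
  them has finitely many zeros in the range concerned.\<close>

lemma finite_periodic_zeros: "finite periodic_zeros"
proof -
  have "(\<lambda>n. K / of_int A ^ n) \<longlonglongrightarrow> 0"
    by (rule LIMSEQ_divide_realpow_zero[OF A_gt(1)])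
  hence "eventually (\<lambda>n. K / of_int A ^ n < 1) sequentially"
    by (rule order_tendstoD) simp
  then obtain r where r: "K / of_int A ^ r < 1"
    by (auto simp: eventually_sequentially)
  have "periodic_zeros \<subseteq> (\<Union>j<r. (\<lambda>y. y * of_int A ^ Suc j) ` {x \<in> {0..<1}. w x = 0})"
  proof
    fix x assume "x \<in> periodic_zeros"
    hence x: "0 \<le> x" "x < 1" "phi x = 0"
      by (auto simp: periodic_zeros_def dest: spec[of _ 0])
    have "\<bar>phi (x / of_int A ^ r) - phi 0\<bar> \<le> K * \<bar>x / of_int A ^ r - 0\<bar>"
      by (rule phi_lipschitz)
    also have "\<dots> = K / of_int A ^ r * x"
      using x zero_less_power[OF A_gt(2), of r] by (simp add: abs_of_pos)
    also have "\<dots> \<le> K / of_int A ^ r * 1"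
      using x K_nonneg less_imp_le[OF zero_less_power[OF A_gt(2), of r]]
      by (intro mult_left_mono divide_nonneg_nonneg) auto
    finally have "phi (x / of_int A ^ r) \<noteq> 0"
      using r by (auto simp: phi_at_0)
    hence "partial_product r x = 0"
      using phi_split[of x r] x by simp
    then obtain j where j: "j < r" "w (x / of_int A ^ Suc j) = 0"
      by (auto simp: partial_product_def)
    have "1 \<le> real_of_int A ^ Suc j"
      using A_ge_2 by (intro one_le_power) simp
    hence "x / of_int A ^ Suc j \<le> x"
      using x divide_left_mono[of 1 "real_of_int A ^ Suc j" x] by simp
    moreover have "0 \<le> x / of_int A ^ Suc j"
      using x \<open>1 \<le> real_of_int A ^ Suc j\<close> by (intro divide_nonneg_nonneg) auto
    ultimately have "x / of_int A ^ Suc j \<in> {x \<in> {0..<1}. w x = 0}"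
      unfolding mem_Collect_eq atLeastLessThan_iff using x(2) j(2) by (blast intro: le_less_trans)
    thus "x \<in> (\<Union>j<r. (\<lambda>y. y * of_int A ^ Suc j) ` {x \<in> {0..<1}. w x = 0})"
      using j by (auto intro!: bexI[of _ j] image_eqI[of _ _ "x / of_int A ^ Suc j"])
  qed
  thus ?thesis
    by (rule finite_subset) (intro finite_UN_I finite_imageI fin_zeros finite_lessThan)
qed

text \<open>
  Each periodic zero has at least one child \<open>(x + l) / A\<close>, and children are pairwise distinct
  modulo 1; since there are only finitely many periodic zeros, each has exactly one child, and
  the full weight 1 sits on it.
\<close>

lemma periodic_zeros_expanding:
  assumes z: "z \<in> periodic_zeros"
  shows "w z = 1" "frac (of_int A * z) \<in> periodic_zeros"
proof -
  let ?Z = periodic_zeros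
  define S where "S = {(x, l). x \<in> ?Z \<and> l \<in> L \<and> w ((x + of_int l) / of_int A) \<noteq> 0}"
  define g where "g = (\<lambda>(x, l). frac ((x + real_of_int l) / of_int A))"
  have weight: "(\<Sum>l\<in>L. (w ((x + of_int l) / of_int A))\<^sup>2) = 1" for x
    using sum_L[of "x / of_int A"] by (simp add: add_divide_distrib)
  have finS: "finite S"
    by (rule finite_subset[of _ "?Z \<times> L"]) (auto simp: S_def finite_periodic_zeros fin_L)
  have g_Z: "g ` S \<subseteq> ?Z"
  proof safe
    fix x l assume "(x, l) \<in> S"
    hence x: "x \<in> ?Z" "w ((x + of_int l) / of_int A) \<noteq> 0"
      by (auto simp: S_def)
    \<comment> \<open>An integer translate of the child is itself a child of an integer translate of
      \<open>x\<close>. At the latter \<open>phi\<close> vanishes while the weight does not, so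
      \<open>phi\<close> vanishes at the child.\<close>
    have "phi (frac ((x + of_int l) / of_int A) + of_int k) = 0" for k
    proof -
      let ?m = "k - \<lfloor>(x + of_int l) / of_int A\<rfloor>"
      have "\<forall>k::int. phi (x + of_int k) = 0"
        using x by (simp add: periodic_zeros_def)
      hence "phi (x + of_int (l + A * ?m)) = 0" ..
      moreover have "(x + of_int (l + A * ?m)) / of_int A = (x + of_int l) / of_int A + of_int ?m"
        by (simp add: field_simps)
      ultimately have "w ((x + of_int l) / of_int A + of_int ?m)
          * phi ((x + of_int l) / of_int A + of_int ?m) = 0"
        using phi_refinement[of "x + of_int (l + A * ?m)"] by metis
      hence "phi ((x + of_int l) / of_int A + of_int ?m) = 0"
        using x(2) by (simp only: periodic) simp
      thus ?thesis
        by (simp add: frac_def algebra_simps)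
    qed
    thus "g (x, l) \<in> ?Z"
      by (auto simp: g_def periodic_zeros_def frac_lt_1)
  qed
  have g_inj: "inj_on g S"
  proof (rule inj_onI, safe)
    fix x l y m assume S: "(x, l) \<in> S" "(y, m) \<in> S" and eq: "g (x, l) = g (y, m)"
    define k where "k = \<lfloor>(x + of_int l) / of_int A\<rfloor> - \<lfloor>(y + of_int m) / of_int A\<rfloor>"
    have "(x + of_int l) / of_int A - (y + of_int m) / of_int A = of_int k"
      using eq by (simp add: g_def frac_def k_def)
    hence "(x + of_int l - (y + of_int m)) / of_int A = of_int k"
      by (simp only: diff_divide_distrib)
    hence k: "x + of_int l - (y + of_int m) = of_int (A * k)"
      by (simp add: divide_eq_eq mult.commute)
    have "x = frac (x + of_int l)" "y = frac (y + of_int m)"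
      using S by (auto simp: S_def periodic_zeros_def frac_eq)
    moreover have "frac (x + of_int l) = frac (y + of_int m + of_int (A * k))"
      using k by (simp add: algebra_simps)
    ultimately show xy: "x = y"
      by (simp add: frac_def)
    show "l = m"
    proof (rule ccontr)
      assume "l \<noteq> m"
      hence "w (of_int l / of_int A - of_int m / of_int A) = 0"
        using S parseval_orthogonal[of L w "\<lambda>l. of_int l / of_int A" l m]
        by (auto simp: fin_L at_0 sum_L S_def)
      moreover have "of_int (l - m) = (of_int (A * k) :: real)"
        using k xy by simp
      hence "of_int l / of_int A - of_int m / of_int A = 0 + (of_int k :: real)"
        by (simp add: field_simps)
      ultimately show False
        using periodic[of 0 k] by (simp add: at_0)
    qed
  qed
  have fst_S: "fst ` S = ?Z"
  proof
    show "?Z \<subseteq> fst ` S"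
    proof
      fix x assume "x \<in> ?Z"
      moreover have "\<exists>l\<in>L. w ((x + of_int l) / of_int A) \<noteq> 0"
      proof (rule ccontr)
        assume "\<not> ?thesis"
        hence "(\<Sum>l\<in>L. (w ((x + of_int l) / of_int A))\<^sup>2) = 0"
          by (intro sum.neutral) auto
        thus False
          using weight[of x] by simp
      qed
      ultimately show "x \<in> fst ` S"
        by (force simp: S_def)
    qed
  qed (auto simp: S_def)
  \<comment> \<open>The number of periodic zeros is at most card S, which equals the number of
    children, again at most the number of periodic zeros. Equality makes \<open>fst\<close>
    injective, so that each zero has one child, and makes \<open>g\<close> onto, so that each zero
    is a child.\<close>
  have "card S = card (g ` S)"
    by (rule card_image[OF g_inj, symmetric])
  moreover have "card (g ` S) \<le> card ?Z"
    by (rule card_mono[OF finite_periodic_zeros g_Z])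
  moreover have "card (fst ` S) \<le> card S"
    by (rule card_image_le[OF finS])
  ultimately have card: "card (g ` S) = card ?Z" "card (fst ` S) = card S"
    using fst_S by auto
  have inj: "inj_on fst S"
    by (rule eq_card_imp_inj_on[OF finS card(2)])
  have "g ` S = ?Z"
    by (rule card_subset_eq[OF finite_periodic_zeros g_Z card(1)])
  then obtain x l where xl: "(x, l) \<in> S" "z = g (x, l)"
    using z by (metis imageE surj_pair)
  have "w ((x + of_int m) / of_int A) = 0" if "m \<in> L - {l}" for m
  proof (rule ccontr)
    assume "w ((x + of_int m) / of_int A) \<noteq> 0"
    hence "(x, m) \<in> S"
      using xl that by (auto simp: S_def)
    thus False
      using inj_onD[OF inj _ xl(1), of "(x, m)"] that by auto
  qed
  hence "(\<Sum>m\<in>L. (w ((x + of_int m) / of_int A))\<^sup>2) = (w ((x + of_int l) / of_int A))\<^sup>2"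
    using xl by (subst sum.remove[of _ l]) (auto simp: fin_L S_def)
  hence "w ((x + of_int l) / of_int A) = 1"
    using weight[of x] nonneg by (simp add: power2_eq_1_iff) (smt (verit))
  moreover have z_eq: "z = (x + of_int l) / of_int A + of_int (- \<lfloor>(x + of_int l) / of_int A\<rfloor>)"
    using xl by (simp add: g_def frac_def)
  ultimately show "w z = 1"
    by (simp only: periodic)
  have "of_int A * z = x + of_int (l - A * \<lfloor>(x + of_int l) / of_int A\<rfloor>)"
    by (subst z_eq) (simp add: field_simps)
  hence "frac (of_int A * z) = frac x"
    by (simp add: frac_def)
  moreover have x: "x \<in> ?Z"
    using xl by (simp add: S_def)
  hence "frac x = x"
    by (simp add: periodic_zeros_def frac_eq)
  ultimately show "frac (of_int A * z) \<in> ?Z"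
    using x by simp
qed

text \<open>The orbit of a periodic zero under x -> A x mod 1 stays in a finite set and so enters a
  cycle. A point z of the cycle has w z = 1 and, for the cycle length R, an integral (A^R - 1) z;
  these are the points that \<open>cycle\<close> excludes.\<close>

lemma periodic_zeros_empty:
  assumes cycle: "\<And>z R. w z = 1 \<Longrightarrow> R > 0 \<Longrightarrow> (of_int A ^ R - 1) * z \<in> \<int> \<Longrightarrow>
    \<exists>k::int. phi (z + of_int k) \<noteq> 0"
  shows "periodic_zeros = {}"
proof (rule ccontr)
  assume "periodic_zeros \<noteq> {}"
  then obtain y where y: "y \<in> periodic_zeros" by auto
  define f where "f x = frac (of_int A * x)" for x :: real
  have orbit: "(f ^^ n) y \<in> periodic_zeros" for n
    by (induction n) (auto simp: f_def y periodic_zeros_expanding)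
  have "\<not> inj (\<lambda>n. (f ^^ n) y)"
    using finite_subset[of "range (\<lambda>n. (f ^^ n) y)" periodic_zeros] orbit finite_periodic_zeros
    by (auto dest: finite_imageD)
  then obtain i j where "(f ^^ i) y = (f ^^ j) y" "i \<noteq> j"
    by (auto simp: inj_on_def)
  then obtain i j where ij: "(f ^^ i) y = (f ^^ j) y" "i < j"
    by (metis linorder_neqE_nat)
  define z where "z = (f ^^ i) y"
  have "(f ^^ (j - i)) z = z"
    using ij funpow_add[of "j - i" i f] by (simp add: z_def)
  moreover have "of_int A ^ n * x - (f ^^ n) x \<in> \<int>" for n x
  proof (induction n)
    case (Suc n)
    have "of_int A ^ Suc n * x - (f ^^ Suc n) x
        = of_int A * (of_int A ^ n * x - (f ^^ n) x) + of_int \<lfloor>of_int A * (f ^^ n) x\<rfloor>"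
      by (simp add: f_def frac_def algebra_simps)
    also have "\<dots> \<in> \<int>"
      using Suc by (intro Ints_add Ints_mult) auto
    finally show ?case .
  qed simp
  ultimately have "of_int A ^ (j - i) * z - z \<in> \<int>"
    by metis
  hence "(of_int A ^ (j - i) - 1) * z \<in> \<int>"
    by (simp add: algebra_simps)
  moreover have z: "z \<in> periodic_zeros"
    unfolding z_def by (rule orbit)
  ultimately show False
    using cycle[of z "j - i"] ij periodic_zeros_expanding(1)[OF z] by (auto simp: periodic_zeros_def)
qed

text \<open>Otherwise there are points of [0,1] all of whose integer translates have
  \<open>phi\<close> below 1/(n+1); by compactness they accumulate, and by continuity the limit
  yields a periodic zero.\<close>

lemma equi_positive:
  assumes empty: "periodic_zeros = {}"
  shows "\<exists>\<epsilon>>0. \<forall>x. \<exists>k::int. phi (x + of_int k) \<ge> \<epsilon>"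
proof (rule ccontr)
  assume "\<not> ?thesis"
  hence "\<exists>x. \<forall>k::int. phi (x + of_int k) < 1 / real (Suc n)" for n
    by (meson not_le of_nat_0_less_iff zero_less_Suc zero_less_divide_1_iff)
  then obtain x0 where x0: "\<And>n k. phi (x0 n + of_int (k::int)) < 1 / real (Suc n)"
    by metis
  define x where "x n = frac (x0 n)" for n
  have x: "phi (x n + of_int k) < 1 / real (Suc n)" for n k
    using x0[of n "k - \<lfloor>x0 n\<rfloor>"] by (simp add: x_def frac_def algebra_simps)
  have "\<forall>n. x n \<in> {0..1}"
    by (auto simp: x_def intro: less_imp_le[OF frac_lt_1])
  then obtain l r where l: "strict_mono r" "(x \<circ> r) \<longlonglongrightarrow> l"
    using compact_Icc[of 0 "1::real"] unfolding compact_def by metis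
  have zero: "phi (l + of_int k) = 0" for k
  proof -
    have "(\<lambda>n. phi ((x \<circ> r) n + of_int k)) \<longlonglongrightarrow> phi (l + of_int k)"
      by (intro isCont_tendsto_compose[OF isCont_phi] tendsto_intros l)
    moreover have "(\<lambda>n. 1 / real (Suc (r n))) \<longlonglongrightarrow> 0"
      using LIMSEQ_subseq_LIMSEQ[OF LIMSEQ_inverse_real_of_nat l(1)]
      by (simp add: o_def divide_inverse)
    ultimately have "phi (l + of_int k) \<le> 0"
      by (rule LIMSEQ_le) (use x in \<open>auto intro!: exI[of _ 0] less_imp_le\<close>)
    thus ?thesis
      using phi_nonneg[of "l + of_int k"] by simp
  qed
  have "phi (frac l + of_int k) = 0" for k
    using zero[of "k - \<lfloor>l\<rfloor>"] by (simp add: frac_def algebra_simps)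
  hence "frac l \<in> periodic_zeros"
    by (auto simp: periodic_zeros_def frac_lt_1)
  thus False
    using empty by simp
qed

end

text \<open>Pairs (l, m) are coded as a l + m, which over a^(n+1) is l / a^n + m / a^(n+1).
  Multiplied by a^n the first part is an integer, invisible to \<open>v n\<close>; so for fixed
  \<open>m\<close> the sum over \<open>l\<close> is the Parseval sum of the first \<open>n\<close>
  factors at a shifted point.\<close>

lemma parseval_dilated_product:
  fixes v :: "nat \<Rightarrow> real \<Rightarrow> real" and a :: int
  assumes a: "a > 0" and v0: "\<And>j. v j 0 = 1" and per: "\<And>j x k. v j (x + of_int k) = v j x"
    and parseval: "\<And>j. \<exists>L::int set. finite L \<and> (\<forall>x. (\<Sum>l\<in>L. (v j (x + of_int l / of_int a))\<^sup>2) = 1)"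
  shows "\<exists>L::int set. finite L \<and>
    (\<forall>x. (\<Sum>l\<in>L. (\<Prod>j<n. v j (of_int a ^ j * (x + of_int l / of_int a ^ n)))\<^sup>2) = 1)"
proof (induction n)
  case 0
  thus ?case
    by (intro exI[of _ "{0}"]) simp
next
  case (Suc n)
  then obtain L where L: "finite L"
    "\<And>x. (\<Sum>l\<in>L. (\<Prod>j<n. v j (of_int a ^ j * (x + of_int l / of_int a ^ n)))\<^sup>2) = 1"
    by auto
  obtain M where M: "finite M" "\<And>x. (\<Sum>m\<in>M. (v n (x + of_int m / of_int a))\<^sup>2) = 1"
    using parseval[of n] by auto
  define V where "V n x = (\<Prod>j<n. v j (of_int a ^ j * x))" for n x
  define f where "f = (\<lambda>(l, m). a * l + m)"
  have a0: "real_of_int a \<noteq> 0"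
    using a by simp
  have eq: "V (Suc n) (x + of_int (f (l, m)) / of_int a ^ Suc n) =
      V n ((x + of_int m / of_int a ^ Suc n) + of_int l / of_int a ^ n)
      * v n (of_int a ^ n * x + of_int m / of_int a)" for x l m
  proof -
    have "of_int (f (l, m)) / real_of_int a ^ Suc n = of_int m / of_int a ^ Suc n + of_int l / of_int a ^ n"
      using a0 by (simp add: f_def field_simps)
    moreover have "of_int a ^ n * (x + of_int (f (l, m)) / of_int a ^ Suc n)
        = of_int a ^ n * x + of_int m / of_int a + real_of_int l"
      using a0 by (simp add: f_def field_simps)
    hence "v n (of_int a ^ n * (x + of_int (f (l, m)) / of_int a ^ Suc n))
        = v n (of_int a ^ n * x + of_int m / of_int a)"
      by (simp only: per)
    ultimately show ?thesis
      by (simp only: V_def prod.lessThan_Suc add.assoc)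
  qed
  have sum: "(\<Sum>q\<in>L \<times> M. (V (Suc n) (x + of_int (f q) / of_int a ^ Suc n))\<^sup>2) = 1" for x
  proof -
    have "(\<Sum>q\<in>L \<times> M. (V (Suc n) (x + of_int (f q) / of_int a ^ Suc n))\<^sup>2)
        = (\<Sum>m\<in>M. \<Sum>l\<in>L. (V (Suc n) (x + of_int (f (l, m)) / of_int a ^ Suc n))\<^sup>2)"
      by (subst sum.swap) (simp add: sum.cartesian_product)
    also have "\<dots> = (\<Sum>m\<in>M. (\<Sum>l\<in>L. (V n ((x + of_int m / of_int a ^ Suc n) + of_int l / of_int a ^ n))\<^sup>2)
        * (v n (of_int a ^ n * x + of_int m / of_int a))\<^sup>2)"
      by (simp only: eq power_mult_distrib sum_distrib_right)
    also have "\<dots> = 1"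
      by (simp only: V_def L(2) mult_1_left M(2))
    finally show ?thesis .
  qed
  have "inj_on (\<lambda>q. of_int (f q) / real_of_int a ^ Suc n) (L \<times> M)"
    by (rule parseval_inj_on[where V = "V (Suc n)"]) (use L M sum in \<open>auto simp: V_def v0\<close>)
  hence "inj_on f (L \<times> M)"
    by (auto simp: inj_on_def)
  hence "(\<Sum>l\<in>f ` (L \<times> M). (V (Suc n) (x + of_int l / of_int a ^ Suc n))\<^sup>2) = 1" for x
    using sum by (simp only: sum.reindex o_def)
  thus ?case
    using L M unfolding V_def by (intro exI[of _ "f ` (L \<times> M)"]) auto
qed

subsection \<open>Analytic properties of means of exponentials\<close>

lemma norm_expo_diff_le: "cmod (expo s x - expo s y) \<le> 2 * pi * \<bar>s\<bar> * \<bar>x - y\<bar>"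
proof -
  have "expo s x - expo s y = expo s y * (expo s (x - y) - 1)"
    by (simp add: right_diff_distrib flip: expo_add_right)
  hence "cmod (expo s x - expo s y) = cmod (expo s (x - y) - 1)"
    by (simp add: norm_mult)
  also have "expo s (x - y) = iexp (2 * pi * s * (x - y))"
    by (simp add: expo_def mult_ac)
  also have "cmod (iexp (2 * pi * s * (x - y)) - 1) \<le> \<bar>2 * pi * s * (x - y)\<bar>"
    using iexp_approx1[of "2 * pi * s * (x - y)" 0] by simp
  finally show ?thesis
    by (simp add: abs_mult)
qed

lemma trig_mean_lipschitz:
  "\<exists>K. \<forall>x y. \<bar>cmod (trig_mean C x) - cmod (trig_mean C y)\<bar> \<le> K * \<bar>x - y\<bar>"
proof (intro exI allI)
  fix x y
  have "\<bar>cmod (trig_mean C x) - cmod (trig_mean C y)\<bar> \<le> cmod (trig_mean C x - trig_mean C y)"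
    by (rule norm_triangle_ineq3)
  also have "trig_mean C x - trig_mean C y =
      (\<Sum>c\<in>C. expo (of_int c) x - expo (of_int c) y) / of_nat (card C)"
    by (simp add: trig_mean_def sum_subtractf diff_divide_distrib)
  also have "cmod \<dots> \<le> (\<Sum>c\<in>C. 2 * pi * \<bar>of_int c\<bar> * \<bar>x - y\<bar>) / card C"
    unfolding norm_divide norm_of_nat
    by (intro divide_right_mono sum_norm_le norm_expo_diff_le) auto
  also have "\<dots> = (\<Sum>c\<in>C. 2 * pi * \<bar>real_of_int c\<bar>) / card C * \<bar>x - y\<bar>"
    by (simp add: sum_distrib_right)
  finally show "\<bar>cmod (trig_mean C x) - cmod (trig_mean C y)\<bar>
      \<le> (\<Sum>c\<in>C. 2 * pi * \<bar>real_of_int c\<bar>) / card C * \<bar>x - y\<bar>" .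
qed

text \<open>Up to a unimodular factor, \<open>trig_mean C\<close> is a nonzero polynomial in \<open>expo 1\<close>.\<close>

lemma finite_trig_mean_zeros_unit:
  assumes C: "finite C" "C \<noteq> {}"
  shows "finite {x \<in> {0..<1}. trig_mean C x = 0}"
proof -
  \<comment> \<open>Subtracting Min C makes the exponents nonnegative and gives constant coefficient
    1, as only the least digit contributes to it; hence \<open>P\<close> is nonzero.\<close>
  define P :: "complex poly" where "P = (\<Sum>c\<in>C. monom 1 (nat (c - Min C)))"
  have "nat (c - Min C) = 0 \<longleftrightarrow> c = Min C" if "c \<in> C" for c
    using Min_le[OF C(1) that] by auto
  hence "coeff P 0 = (\<Sum>c\<in>C. if c = Min C then 1 else 0)"
    unfolding P_def coeff_sum by (intro sum.cong) (simp_all add: coeff_monom)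
  also have "\<dots> = 1"
    using C by (simp add: Min_in)
  finally have "P \<noteq> 0"
    by auto
  have root: "poly P (expo 1 x) = 0" if "trig_mean C x = 0" for x
  proof -
    have pow: "expo 1 x ^ n = expo (of_nat n) x" for n
      by (induction n) (simp_all add: expo_add_left)
    have "poly P (expo 1 x) = (\<Sum>c\<in>C. expo (of_int (c - Min C)) x)"
      unfolding P_def poly_sum poly_monom pow using C by (intro sum.cong) simp_all
    also have "\<dots> = expo (of_int (- Min C)) x * (\<Sum>c\<in>C. expo (of_int c) x)"
      by (simp add: sum_distrib_left flip: expo_add_left)
    also have "\<dots> = 0"
      using that C by (simp add: trig_mean_def)
    finally show ?thesis .
  qed
  have inj: "inj_on (expo 1) {0..<1}"
  proof (rule inj_onI)
    fix x y :: real assume xy: "x \<in> {0..<1}" "y \<in> {0..<1}" "expo 1 x = expo 1 y"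
    hence "x - y \<in> \<int>"
      using expo_eq_expo_iff[of x 1 y] by (simp add: expo_commute)
    then obtain k where k: "x - y = of_int k"
      by (auto elim: Ints_cases)
    moreover have "\<bar>x - y\<bar> < 1"
      using xy by (auto simp: abs_less_iff)
    ultimately have "\<bar>k\<bar> < 1"
      by linarith
    thus "x = y"
      using k by simp
  qed
  have "finite (expo 1 ` {x \<in> {0..<1}. trig_mean C x = 0})"
    by (rule finite_subset[OF _ poly_roots_finite[OF \<open>P \<noteq> 0\<close>]]) (auto simp: root)
  thus ?thesis
    by (rule finite_imageD) (rule inj_on_subset[OF inj], auto)
qed

lemma finite_trig_mean_zeros:
  assumes C: "finite C" "C \<noteq> {}"
  shows "finite {x \<in> {0..<R}. trig_mean C x = 0}"
proof (rule finite_subset)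
  show "{x \<in> {0..<R}. trig_mean C x = 0}
      \<subseteq> (\<lambda>(z, k). z + of_int k) ` ({x \<in> {0..<1}. trig_mean C x = 0} \<times> {0..\<lfloor>R\<rfloor>})"
  proof
    fix x assume x: "x \<in> {x \<in> {0..<R}. trig_mean C x = 0}"
    have "trig_mean C (frac x) = 0"
      using x trig_mean_add_int[of C "frac x" "\<lfloor>x\<rfloor>"] by (simp add: frac_def)
    thus "x \<in> (\<lambda>(z, k). z + of_int k) ` ({x \<in> {0..<1}. trig_mean C x = 0} \<times> {0..\<lfloor>R\<rfloor>})"
      using x \<open>trig_mean C (frac x) = 0\<close>
      by (intro image_eqI[of _ _ "(frac x, \<lfloor>x\<rfloor>)"])
        (auto simp: frac_lt_1 frac_def[symmetric] floor_mono, simp add: frac_def)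
  qed
  show "finite ((\<lambda>(z, k). z + real_of_int k) ` ({x \<in> {0..<1}. trig_mean C x = 0} \<times> {0..\<lfloor>R\<rfloor>}))"
    using C by (intro finite_imageI finite_cartesian_product finite_trig_mean_zeros_unit) auto
qed

text \<open>A mean of unit complex numbers has modulus 1 only if they all coincide, and equality of
  two exponentials at \<open>x\<close> is an integrality condition on the difference of their
  frequencies.\<close>

lemma trig_mean_extremal:
  assumes C: "finite C" and 1: "cmod (trig_mean C x) = 1" and cd: "c \<in> C" "d \<in> C"
  shows "of_int (c - d) * x \<in> \<int>"
proof -
  have "card C > 0"
    using C cd by (auto simp: card_gt_0_iff)
  define u where "u = trig_mean C x"
  have "(\<Sum>c\<in>C. expo (of_int c) x) = of_nat (card C) * u"
    using \<open>card C > 0\<close> by (simp add: u_def trig_mean_def)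
  hence "(\<Sum>c\<in>C. Re (expo (of_int c) x * cnj u)) = Re (of_nat (card C) * (u * cnj u))"
    by (simp only: Re_sum[symmetric] sum_distrib_right[symmetric] mult.assoc)
  also have "u * cnj u = 1"
    using 1 by (simp add: u_def flip: complex_norm_square)
  finally have sum: "(\<Sum>c\<in>C. 1 - Re (expo (of_int c) x * cnj u)) = 0"
    by (simp add: sum_subtractf)
  have le: "Re (expo (of_int c) x * cnj u) \<le> 1" for c
    using complex_Re_le_cmod[of "expo (of_int c) x * cnj u"] 1 by (simp add: norm_mult u_def)
  have eq: "expo (of_int c) x = u" if "c \<in> C" for c
  proof -
    define v where "v = expo (of_int c) x * cnj u"
    have "Re v = 1"
      using sum_nonneg_0[OF C _ sum that] le by (auto simp: v_def)
    moreover have "cmod v = 1"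
      using 1 by (simp add: v_def norm_mult u_def)
    ultimately have "v = 1"
      by (simp add: complex_eq_iff cmod_def)
    hence "v * u = u" by simp
    moreover have "v * u = expo (of_int c) x * (u * cnj u)"
      by (simp add: v_def mult_ac)
    ultimately show ?thesis
      using \<open>u * cnj u = 1\<close> by simp
  qed
  show ?thesis
    using eq[OF cd(1)] eq[OF cd(2)] expo_eq_expo_iff[of "of_int c" x "of_int d"] by simp
qed

subsection \<open>The invariant measure\<close>

lemma fourier_transform_eq_char: "fourier_transform M t = char M (2 * pi * t)"
  by (simp add: fourier_transform_def char_def expo_def mult_ac)

lemma isCont_fourier_transform:
  assumes "prob_space M" "sets M = sets borel"
  shows "isCont (fourier_transform M) t"
proof -
  interpret real_distribution M
    unfolding real_distribution_def real_distribution_axioms_def using assms by simp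
  have "isCont (\<lambda>t. char M (2 * pi * t)) t"
    by (rule isCont_o2[OF _ isCont_char]) (intro continuous_intros)
  thus ?thesis
    by (simp add: fourier_transform_eq_char[abs_def])
qed

context
  fixes A :: int and B :: "int set"
  assumes A_ge_2: "A \<ge> 2" and B: "finite B" "B \<noteq> {}"
begin

text \<open>
  Continuous functions with compact support approximate the exponentials boundedly, so the
  invariance extends to the latter.
\<close>

lemma fourier_transform_invariant:
  assumes inv: "is_invariant_measure (affine_ifs A) B M"
  shows "fourier_transform M t = trig_mean B (t / of_int A) * fourier_transform M (t / of_int A)"
proof -
  have M: "prob_space M" "sets M = sets borel"
    using inv by (auto simp: is_invariant_measure_def)
  interpret prob_space M by (rule M)
  note [measurable_cong] = M(2)
  \<comment> \<open>Trapezoids, equal to 1 for |x| <= n and to 0 for |x| >= n + 1.\<close>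
  define cut where "cut n x = max 0 (min 1 (real n + 1 - \<bar>x\<bar>))" for n x
  define f where "f n x = of_real (cut n x) * expo t x" for n x
  have lim: "(\<lambda>n. \<integral>x. f n (g x) \<partial>M) \<longlonglongrightarrow> (\<integral>x. expo t (g x) \<partial>M)"
    if [measurable]: "g \<in> borel_measurable borel" for g
  proof (rule integral_dominated_convergence[where w = "\<lambda>_. 1"])
    show "AE x in M. (\<lambda>n. f n (g x)) \<longlonglongrightarrow> expo t (g x)"
    proof (rule AE_I2)
      fix x
      have "eventually (\<lambda>n. real n > \<bar>g x\<bar>) sequentially"
        by (rule filterlim_at_top_dense[THEN iffD1, rule_format, OF filterlim_real_sequentially])
      hence "eventually (\<lambda>n. f n (g x) = expo t (g x)) sequentially"
        by eventually_elim (simp add: f_def cut_def)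
      thus "(\<lambda>n. f n (g x)) \<longlonglongrightarrow> expo t (g x)"
        by (rule tendsto_eventually)
    qed
    show "AE x in M. cmod (f n (g x)) \<le> 1" for n
      by (simp add: f_def cut_def norm_mult)
  qed (auto simp: f_def cut_def)
  have cont: "continuous_on UNIV (f n)" for n
    unfolding f_def cut_def by (intro continuous_intros)
  have "{x. f n x \<noteq> 0} \<subseteq> {- (real n + 1)..real n + 1}" for n
    by (auto simp: f_def cut_def)
  hence "compact (closure {x. f n x \<noteq> 0})" for n
    by (meson bounded_closed_interval bounded_subset compact_closure)
  with cont have eq: "(\<integral>x. f n x \<partial>M) =
      1 / of_nat (card B) * (\<Sum>b\<in>B. \<integral>x. f n (affine_ifs A b x) \<partial>M)" for n
    using inv unfolding is_invariant_measure_def o_def by blast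
  have [measurable]: "affine_ifs A b \<in> borel_measurable borel" for b
    unfolding affine_ifs_def by measurable
  have "(\<lambda>n. \<integral>x. f n x \<partial>M) \<longlonglongrightarrow>
      1 / of_nat (card B) * (\<Sum>b\<in>B. \<integral>x. expo t (affine_ifs A b x) \<partial>M)"
    unfolding eq by (intro tendsto_intros lim) measurable
  moreover have "(\<lambda>n. \<integral>x. f n x \<partial>M) \<longlonglongrightarrow> fourier_transform M t"
    unfolding fourier_transform_def by (rule lim[of "\<lambda>x. x"]) simp
  ultimately have "fourier_transform M t =
      1 / of_nat (card B) * (\<Sum>b\<in>B. \<integral>x. expo t (affine_ifs A b x) \<partial>M)"
    using LIMSEQ_unique by blast
  also have "\<dots> = 1 / of_nat (card B) *
      (\<Sum>b\<in>B. expo (of_int b) (t / of_int A) * fourier_transform M (t / of_int A))"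
  proof -
    {
      fix b
      have "expo t (affine_ifs A b x) = expo (of_int b) (t / of_int A) * expo (t / of_int A) x" for x
        by (simp add: expo_eq_cis affine_ifs_def cis_mult divide_inverse algebra_simps)
      hence "(\<integral>x. expo t (affine_ifs A b x) \<partial>M) =
          expo (of_int b) (t / of_int A) * fourier_transform M (t / of_int A)"
        by (simp add: fourier_transform_def)
    }
    thus ?thesis by simp
  qed
  finally show ?thesis
    by (simp add: trig_mean_def sum_distrib_right)
qed

text \<open>Both transforms are continuous, equal 1 at 0 and satisfy the same refinement equation,
  so they coincide; by Levy's theorem they determine the measures.\<close>

lemma invariant_measure_unique:
  assumes "is_invariant_measure (affine_ifs A) B M" "is_invariant_measure (affine_ifs A) B N"
  shows "M = N"
proof -
  have M: "prob_space M" "sets M = sets borel" and N: "prob_space N" "sets N = sets borel"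
    using assms by (auto simp: is_invariant_measure_def)
  have A: "real_of_int A > 1"
    using A_ge_2 by simp
  have "fourier_transform M t = fourier_transform N t" for t
    by (rule refinement_equation_unique[OF A norm_trig_mean_le_1
          fourier_transform_invariant[OF assms(1)] fourier_transform_invariant[OF assms(2)]
          isCont_fourier_transform[OF M] isCont_fourier_transform[OF N]])
       (simp add: fourier_transform_0 M N)
  hence "char M (2 * pi * (t / (2 * pi))) = char N (2 * pi * (t / (2 * pi)))" for t
    unfolding fourier_transform_eq_char .
  hence "char M = char N"
    by auto
  thus ?thesis
    by (intro Levy_uniqueness) (simp_all add: real_distribution_def real_distribution_axioms_def M N)
qed

text \<open>The measure is the law of the random base-\<open>A\<close> expansion with independent
  uniform digits from \<open>B\<close>. Prefixing a digit to the stream applies the corresponding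
  map, which gives invariance, and a geometric series bounds the support.\<close>

lemma ex_invariant_measure:
  "\<exists>M R. is_invariant_measure (affine_ifs A) B M \<and> (AE x in M. \<bar>x\<bar> \<le> R)"
proof -
  define P where "P = measure_pmf (pmf_of_set B)"
  define S where "S = stream_space P"
  \<comment> \<open>The value 0 outside \<open>B\<close> makes the bound \<open>D\<close>, and hence
    convergence of the series, hold for every stream and not only almost surely.\<close>
  define d where "d b = (if b \<in> B then real_of_int b else 0)" for b
  define D where "D = (\<Sum>b\<in>B. \<bar>real_of_int b\<bar>)"
  define X where "X s = (\<Sum>i. d (s !! i) / of_int A ^ Suc i)" for s
  define R where "R = (\<Sum>i. D / real_of_int A ^ Suc i)"
  interpret P: prob_space P
    unfolding P_def by (rule measure_pmf.prob_space_axioms)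
  interpret S: prob_space S
    unfolding S_def by (rule P.prob_space_stream_space)
  have A: "real_of_int A > 1"
    using A_ge_2 by simp
  have d_le: "\<bar>d b\<bar> \<le> D" for b
    unfolding d_def D_def using B by (auto intro: member_le_sum sum_nonneg)
  have summable_D: "summable (\<lambda>i. D / real_of_int A ^ Suc i)"
  proof -
    have "summable (\<lambda>i. D / real_of_int A * (1 / real_of_int A) ^ i)"
      using A by (intro summable_mult summable_geometric) simp
    thus ?thesis
      by (simp add: power_divide)
  qed
  have term_le: "norm (d (s !! i) / of_int A ^ Suc i) \<le> D / of_int A ^ Suc i" for s i
  proof -
    have "real_of_int A ^ Suc i > 0"
      using A by (intro zero_less_power) simp
    thus ?thesis
      using d_le by (simp only: real_norm_def abs_divide abs_of_pos) (simp add: divide_right_mono)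
  qed
  have summable: "summable (\<lambda>i. d (s !! i) / of_int A ^ Suc i)" for s
    by (rule summable_comparison_test'[OF summable_D, of 0]) (rule term_le)
  have X_le: "\<bar>X s\<bar> \<le> R" for s
    using norm_suminf_le[OF term_le[of s] summable_D] by (simp add: X_def R_def)
  have X_Stream: "X (b ## s) = (d b + X s) / of_int A" for b s
  proof -
    have "X (b ## s) = (\<Sum>i. d ((b ## s) !! Suc i) / of_int A ^ Suc (Suc i)) + d b / of_int A"
      unfolding X_def by (subst suminf_split_head[OF summable]) simp
    also have "(\<lambda>i. d ((b ## s) !! Suc i) / of_int A ^ Suc (Suc i)) =
        (\<lambda>i. d (s !! i) / of_int A ^ Suc i / of_int A)"
      by (simp add: mult_ac)
    also have "(\<Sum>i. d (s !! i) / of_int A ^ Suc i / of_int A) = X s / of_int A"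
      unfolding X_def by (rule suminf_divide[OF summable])
    finally show ?thesis
      by (simp add: add_divide_distrib)
  qed
  have [measurable]: "d \<in> borel_measurable P"
    by (simp add: P_def)
  have snth [measurable]: "(\<lambda>s. s !! i) \<in> measurable S P" for i
    unfolding S_def by (rule measurable_snth)
  have X_meas [measurable]: "X \<in> borel_measurable S"
    unfolding X_def by measurable
  define M where "M = distr S borel X"
  have sets_M [simp, measurable_cong]: "sets M = sets borel"
    by (simp add: M_def)
  interpret M: prob_space M
    unfolding M_def by (rule S.prob_space_distr) measurable
  interpret PM: pair_prob_space P M ..
  define g where "g = (\<lambda>(b, x). (d b + x) / real_of_int A)"
  have g_meas [measurable]: "g \<in> borel_measurable (P \<Otimes>\<^sub>M M)"
    unfolding g_def by measurable
  have M_eq: "M = distr (P \<Otimes>\<^sub>M M) borel g"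
  proof (rule measure_eqI)
    fix Y assume "Y \<in> sets M"
    hence Y [measurable]: "Y \<in> sets borel" by simp
    have "emeasure M Y = (\<integral>\<^sup>+x. indicator Y x \<partial>M)"
      by simp
    also have "\<dots> = (\<integral>\<^sup>+s. indicator Y (X s) \<partial>S)"
      unfolding M_def by (rule nn_integral_distr) measurable
    also have "\<dots> = (\<integral>\<^sup>+b. \<integral>\<^sup>+s. indicator Y (X (b ## s)) \<partial>S \<partial>P)"
      unfolding S_def by (rule P.nn_integral_stream_space) (unfold S_def[symmetric], measurable)
    also have "\<dots> = (\<integral>\<^sup>+b. \<integral>\<^sup>+x. indicator Y (g (b, x)) \<partial>M \<partial>P)"
      unfolding M_def X_Stream g_def split by (subst nn_integral_distr) auto
    also have "\<dots> = (\<integral>\<^sup>+z. indicator Y (g z) \<partial>(P \<Otimes>\<^sub>M M))"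
      by (rule M.nn_integral_fst) measurable
    also have "\<dots> = (\<integral>\<^sup>+x. indicator Y x \<partial>distr (P \<Otimes>\<^sub>M M) borel g)"
      by (rule nn_integral_distr [symmetric]) measurable
    also have "\<dots> = emeasure (distr (P \<Otimes>\<^sub>M M) borel g) Y"
      by simp
    finally show "emeasure M Y = emeasure (distr (P \<Otimes>\<^sub>M M) borel g) Y" .
  qed simp
  have "is_invariant_measure (affine_ifs A) B M"
    unfolding is_invariant_measure_def
  proof (intro conjI allI impI)
    show "prob_space M"
      by (rule M.prob_space_axioms)
    fix f :: "real \<Rightarrow> complex"
    assume f: "continuous_on UNIV f \<and> compact (closure {x. f x \<noteq> 0})"
    hence f_meas [measurable]: "f \<in> borel_measurable borel"
      by (intro borel_measurable_continuous_onI) auto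
    have "compact (f ` closure {x. f x \<noteq> 0})"
      using f by (intro compact_continuous_image) (auto intro: continuous_on_subset)
    hence "bounded (f ` closure {x. f x \<noteq> 0})"
      by (rule compact_imp_bounded)
    then obtain K where "\<forall>x\<in>closure {x. f x \<noteq> 0}. cmod (f x) \<le> K"
      by (auto simp: bounded_iff)
    hence "cmod (f x) \<le> max K 0" if "f x \<noteq> 0" for x
      using closure_subset[of "{x. f x \<noteq> 0}"] that by (auto simp: le_max_iff_disj)
    hence "cmod (f x) \<le> max K 0" for x
      by (cases "f x = 0") auto
    hence int: "integrable (P \<Otimes>\<^sub>M M) (\<lambda>z. f (g z))"
      by (intro PM.P.integrable_const_bound[where B = "max K 0"]) auto
    have "(\<integral>x. f x \<partial>M) = (\<integral>z. f (g z) \<partial>(P \<Otimes>\<^sub>M M))"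
      by (subst M_eq) (rule integral_distr; measurable)
    also have "\<dots> = (\<integral>b. \<integral>x. f (g (b, x)) \<partial>M \<partial>P)"
      by (rule PM.integral_fst'[OF int, symmetric])
    also have "\<dots> = (\<Sum>b\<in>B. pmf (pmf_of_set B) b *\<^sub>R (\<integral>x. f (g (b, x)) \<partial>M))"
      unfolding P_def by (rule integral_measure_pmf) (use B in auto)
    also have "\<dots> = (\<Sum>b\<in>B. 1 / of_nat (card B) * (\<integral>x. (f \<circ> affine_ifs A b) x \<partial>M))"
    proof (rule sum.cong[OF refl])
      fix b assume "b \<in> B"
      moreover from this have "g (b, x) = affine_ifs A b x" for x
        by (simp add: g_def d_def affine_ifs_def divide_inverse mult.commute add.commute)
      ultimately show "pmf (pmf_of_set B) b *\<^sub>R (\<integral>x. f (g (b, x)) \<partial>M) =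
          1 / of_nat (card B) * (\<integral>x. (f \<circ> affine_ifs A b) x \<partial>M)"
        using B by (simp add: scaleR_conv_of_real)
    qed
    finally show "(\<integral>x. f x \<partial>M) = 1 / of_nat (card B) * (\<Sum>b\<in>B. \<integral>x. (f \<circ> affine_ifs A b) x \<partial>M)"
      by (simp only: sum_distrib_left)
  qed simp
  moreover have "AE x in M. \<bar>x\<bar> \<le> R"
    unfolding M_def by (subst AE_distr_iff) (auto simp: X_le)
  ultimately show ?thesis by blast
qed

lemma is_invariant_measure_invariant_measure:
  "is_invariant_measure (affine_ifs A) B (invariant_measure (affine_ifs A) B)"
proof -
  obtain M where M: "is_invariant_measure (affine_ifs A) B M"
    using ex_invariant_measure by blast
  show ?thesis
    unfolding invariant_measure_def by (rule theI[where P = "is_invariant_measure (affine_ifs A) B", OF M invariant_measure_unique[OF _ M]])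
qed

lemma AE_invariant_measure_bounded:
  "\<exists>R. AE x in invariant_measure (affine_ifs A) B. \<bar>x\<bar> \<le> R"
proof -
  obtain M R where M: "is_invariant_measure (affine_ifs A) B M" and R: "AE x in M. \<bar>x\<bar> \<le> R"
    using ex_invariant_measure by blast
  have "M = invariant_measure (affine_ifs A) B"
    by (rule invariant_measure_unique[OF M is_invariant_measure_invariant_measure])
  thus ?thesis
    using R by blast
qed

end

subsection \<open>Density of trigonometric polynomials\<close>

text \<open>The linear span in inductive form, so that closure properties follow by induction
  without bookkeeping of index sets; \<open>expo_span_explicit\<close> recovers the
  coefficients.\<close>

inductive_set expo_span :: "real set \<Rightarrow> (real \<Rightarrow> complex) set" for \<Lambda> :: "real set" where
  zero: "(\<lambda>x. 0) \<in> expo_span \<Lambda>"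
| expo: "s \<in> \<Lambda> \<Longrightarrow> (\<lambda>x. c * expo s x) \<in> expo_span \<Lambda>"
| add: "f \<in> expo_span \<Lambda> \<Longrightarrow> g \<in> expo_span \<Lambda> \<Longrightarrow> (\<lambda>x. f x + g x) \<in> expo_span \<Lambda>"

lemma expo_span_cmult: "f \<in> expo_span \<Lambda> \<Longrightarrow> (\<lambda>x. c * f x) \<in> expo_span \<Lambda>"
proof (induction rule: expo_span.induct)
  case (expo s d)
  thus ?case
    using expo_span.expo[of s \<Lambda> "c * d"] by (simp add: mult.assoc)
next
  case (add f g)
  thus ?case
    using expo_span.add by (fastforce simp: ring_distribs)
qed (simp add: expo_span.zero)

lemma expo_span_mult:
  assumes f: "f \<in> expo_span UNIV" and g: "g \<in> expo_span UNIV"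
  shows "(\<lambda>x. f x * g x) \<in> expo_span UNIV"
  using f
proof (induction rule: expo_span.induct)
  case (expo s c)
  have "(\<lambda>x. expo s x * g x) \<in> expo_span UNIV"
    using g
  proof (induction rule: expo_span.induct)
    case (expo t d)
    have "(\<lambda>x. expo s x * (d * expo t x)) = (\<lambda>x. d * expo (s + t) x)"
      by (simp add: expo_add_left mult_ac)
    thus ?case
      by (simp add: expo_span.expo)
  next
    case (add f g)
    thus ?case
      using expo_span.add by (fastforce simp: ring_distribs)
  qed (simp add: expo_span.zero)
  from expo_span_cmult[OF this, of c] show ?case
    by (simp add: mult.assoc)
next
  case (add h k)
  thus ?case
    using expo_span.add by (fastforce simp: ring_distribs)
qed (simp add: expo_span.zero)

lemma continuous_on_expo_span: "f \<in> expo_span \<Lambda> \<Longrightarrow> continuous_on S f"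
  by (induction rule: expo_span.induct) (auto intro!: continuous_intros)

lemma expo_span_bounded: "f \<in> expo_span \<Lambda> \<Longrightarrow> \<exists>K. \<forall>x. cmod (f x) \<le> K"
proof (induction rule: expo_span.induct)
  case (add f g)
  then obtain K L where "\<And>x. cmod (f x) \<le> K" "\<And>x. cmod (g x) \<le> L"
    by blast
  hence "cmod (f x + g x) \<le> K + L" for x
    by (intro norm_triangle_mono)
  thus ?case by blast
qed (auto simp: norm_mult)

lemma expo_span_explicit:
  "f \<in> expo_span \<Lambda> \<Longrightarrow> \<exists>F c. finite F \<and> F \<subseteq> \<Lambda> \<and> (\<forall>s. s \<notin> F \<longrightarrow> c s = 0) \<and>
     f = (\<lambda>x. \<Sum>s\<in>F. c s * expo s x)"
proof (induction rule: expo_span.induct)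
  case zero
  thus ?case
    by (intro exI[of _ "{}"] exI[of _ "\<lambda>_. 0"]) simp
next
  case (expo s c)
  thus ?case
    by (intro exI[of _ "{s}"] exI[of _ "\<lambda>t. if t = s then c else 0"]) auto
next
  case (add f g)
  then obtain F c G d where
    F: "finite F" "F \<subseteq> \<Lambda>" "\<And>s. s \<notin> F \<Longrightarrow> c s = 0" "f = (\<lambda>x. \<Sum>s\<in>F. c s * expo s x)" and
    G: "finite G" "G \<subseteq> \<Lambda>" "\<And>s. s \<notin> G \<Longrightarrow> d s = 0" "g = (\<lambda>x. \<Sum>s\<in>G. d s * expo s x)"
    by blast
  have "(\<Sum>s\<in>F. c s * expo s x) = (\<Sum>s\<in>F \<union> G. c s * expo s x)" for x
    by (rule sum.mono_neutral_left) (use F G in auto)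
  moreover have "(\<Sum>s\<in>G. d s * expo s x) = (\<Sum>s\<in>F \<union> G. d s * expo s x)" for x
    by (rule sum.mono_neutral_left) (use F G in auto)
  ultimately have "(\<lambda>x. f x + g x) = (\<lambda>x. \<Sum>s\<in>F \<union> G. (c s + d s) * expo s x)"
    by (simp add: F(4) G(4) sum.distrib ring_distribs)
  thus ?case
    using F G by (intro exI[of _ "F \<union> G"] exI[of _ "\<lambda>s. c s + d s"]) auto
qed

lemma real_trig_separates:
  assumes "x \<in> {-R..R}" "y \<in> {-R..R}" "x \<noteq> y" "R > 0"
  shows "\<exists>f. (\<lambda>x. complex_of_real (f x)) \<in> expo_span UNIV \<and> f x \<noteq> f y"
proof (intro exI conjI)
  \<comment> \<open>With this frequency 2 pi t z runs through [-pi/2, pi/2] as z runs through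
    [-R, R], and there the sine is injective.\<close>
  define t where "t = 1 / (4 * R)"
  have arg: "2 * pi * t * z \<in> {-(pi / 2)..pi / 2}" if "z \<in> {-R..R}" for z
  proof -
    have "- 1 \<le> z / R" "z / R \<le> 1"
      using that assms(4) by (auto simp: field_simps)
    hence "pi / 2 * (- 1) \<le> pi / 2 * (z / R)" "pi / 2 * (z / R) \<le> pi / 2 * 1"
      by (intro mult_left_mono; simp)+
    moreover have "2 * pi * t * z = pi / 2 * (z / R)"
      by (simp add: t_def)
    ultimately show ?thesis
      by simp
  qed
  have "(\<lambda>x. complex_of_real (sin (2 * pi * t * x))) =
      (\<lambda>x. (1 / (2 * \<i>)) * expo t x + (- 1 / (2 * \<i>)) * expo (- t) x)"
    by (simp add: fun_eq_iff expo_eq_cis complex_eq_iff Re_divide Im_divide)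
  also have "\<dots> \<in> expo_span UNIV"
    by (intro expo_span.add expo_span.expo) auto
  finally show "(\<lambda>x. complex_of_real (sin (2 * pi * t * x))) \<in> expo_span UNIV" .
  show "sin (2 * pi * t * x) \<noteq> sin (2 * pi * t * y)"
  proof
    assume "sin (2 * pi * t * x) = sin (2 * pi * t * y)"
    hence "2 * pi * t * x = 2 * pi * t * y"
      using arg[OF assms(1)] arg[OF assms(2)] unfolding atLeastAtMost_iff
      by (blast intro: sin_inj_pi)
    thus False
      using assms by (simp add: t_def)
  qed
qed

lemma trig_approximation:
  fixes g :: "real \<Rightarrow> real"
  assumes g: "continuous_on {-R..R} g" and "R > 0" "e > 0"
  shows "\<exists>f\<in>expo_span UNIV. \<forall>x\<in>{-R..R}. cmod (of_real (g x) - f x) < e"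
proof -
  let ?P = "\<lambda>f :: real \<Rightarrow> real. (\<lambda>x. complex_of_real (f x)) \<in> expo_span UNIV"
  have "\<exists>f. ?P f \<and> (\<forall>x\<in>{-R..R}. \<bar>g x - f x\<bar> < e)"
  proof (rule Stone_Weierstrass_HOL)
    show "?P (\<lambda>x. c)" for c
      using expo_span.expo[of 0 UNIV "of_real c"] by simp
    show "continuous_on {-R..R} f" if "?P f" for f
      using continuous_on_Re[OF continuous_on_expo_span[OF that]] by simp
    show "?P (\<lambda>x. f x + h x)" if "?P f \<and> ?P h" for f h
      using that expo_span.add[of "\<lambda>x. of_real (f x)" UNIV "\<lambda>x. of_real (h x)"] by simp
    show "?P (\<lambda>x. f x * h x)" if "?P f \<and> ?P h" for f h
      using that expo_span_mult[of "\<lambda>x. of_real (f x)" "\<lambda>x. of_real (h x)"] by simp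
  qed (use assms real_trig_separates in auto)
  then obtain f where f: "?P f" "\<And>x. x \<in> {-R..R} \<Longrightarrow> \<bar>g x - f x\<bar> < e"
    by blast
  hence "cmod (of_real (g x) - of_real (f x)) < e" if "x \<in> {-R..R}" for x
    using that by (simp only: of_real_diff [symmetric] norm_of_real)
  thus ?thesis
    using f(1) by (intro bexI[of _ "\<lambda>x. of_real (f x)"]) auto
qed

section \<open>From exponentials to all of L2 for a measure of bounded support\<close>

context
  fixes M :: "real measure" and \<Lambda> :: "real set"
  assumes M: "prob_space M" "sets M = sets borel"
begin

interpretation prob_space M by (rule M)

declare M(2) [measurable_cong]

text \<open>Squared distances allow the pointwise bound |u + v|^2 <= 2 |u|^2 + 2 |v|^2 in place of
  Minkowski's inequality; the price is a factor 2, which is why errors are split into quarters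
  below.\<close>

definition L2_dist2 :: "(real \<Rightarrow> complex) \<Rightarrow> (real \<Rightarrow> complex) \<Rightarrow> real" where
  "L2_dist2 f g = (\<integral>x. (cmod (f x - g x))\<^sup>2 \<partial>M)"

definition approximable :: "(real \<Rightarrow> complex) \<Rightarrow> bool" where
  "approximable f \<longleftrightarrow> f \<in> square_integrable M \<and>
     (\<forall>\<epsilon>>0. \<exists>g\<in>expo_span \<Lambda>. L2_dist2 f g < \<epsilon>)"

lemma norm_add_square_le: "(cmod (u + v))\<^sup>2 \<le> 2 * (cmod u)\<^sup>2 + 2 * (cmod v)\<^sup>2"
proof -
  have "(cmod (u + v))\<^sup>2 \<le> (cmod u + cmod v)\<^sup>2"
    by (intro power_mono norm_triangle_ineq) auto
  also have "\<dots> \<le> 2 * (cmod u)\<^sup>2 + 2 * (cmod v)\<^sup>2"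
    using sum_squares_bound[of "cmod u" "cmod v"] by (simp add: power2_sum)
  finally show ?thesis .
qed

lemma square_integrable_measurable: "f \<in> square_integrable M \<Longrightarrow> f \<in> borel_measurable M"
  by (simp add: square_integrable_def)

lemma square_integrable_add:
  assumes "f \<in> square_integrable M" "g \<in> square_integrable M"
  shows "(\<lambda>x. f x + g x) \<in> square_integrable M"
proof -
  note [measurable] = assms[THEN square_integrable_measurable]
  have "integrable M (\<lambda>x. (cmod (f x + g x))\<^sup>2)"
  proof (rule Bochner_Integration.integrable_bound)
    show "integrable M (\<lambda>x. 2 * (cmod (f x))\<^sup>2 + 2 * (cmod (g x))\<^sup>2)"
      using assms by (intro Bochner_Integration.integrable_add integrable_mult_right)
        (auto simp: square_integrable_def)
  qed (auto intro!: AE_I2 simp: norm_add_square_le)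
  thus ?thesis
    by (simp add: square_integrable_def)
qed

lemma square_integrable_cmult:
  "f \<in> square_integrable M \<Longrightarrow> (\<lambda>x. c * f x) \<in> square_integrable M"
  by (auto simp: square_integrable_def norm_mult power_mult_distrib)

lemma square_integrable_diff:
  assumes "f \<in> square_integrable M" "g \<in> square_integrable M"
  shows "(\<lambda>x. f x - g x) \<in> square_integrable M"
  using square_integrable_add[OF assms(1) square_integrable_cmult[OF assms(2), of "-1"]] by simp

lemma square_integrable_bounded:
  assumes [measurable]: "f \<in> borel_measurable M" and K: "\<And>x. cmod (f x) \<le> K"
  shows "f \<in> square_integrable M"
proof -
  have "integrable M (\<lambda>x. (cmod (f x))\<^sup>2)"
    by (rule integrable_const_bound[where B = "K\<^sup>2"]) (auto intro!: AE_I2 power_mono K)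
  thus ?thesis
    by (simp add: square_integrable_def)
qed

lemma square_integrable_expo_span:
  assumes "f \<in> expo_span I"
  shows "f \<in> square_integrable M"
proof -
  have "f \<in> borel_measurable borel"
    by (intro borel_measurable_continuous_onI continuous_on_expo_span[OF assms])
  hence "f \<in> borel_measurable M"
    by (simp add: measurable_cong_sets[OF M(2) refl])
  thus ?thesis
    using expo_span_bounded[OF assms] square_integrable_bounded by blast
qed

lemma integrable_L2_dist2:
  assumes "f \<in> square_integrable M" "g \<in> square_integrable M"
  shows "integrable M (\<lambda>x. (cmod (f x - g x))\<^sup>2)"
  using square_integrable_diff[OF assms] by (simp add: square_integrable_def)

lemma L2_dist2_add_le:
  assumes "f \<in> square_integrable M" "g \<in> square_integrable M"
    "f' \<in> square_integrable M" "g' \<in> square_integrable M"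
  shows "L2_dist2 (\<lambda>x. f x + f' x) (\<lambda>x. g x + g' x) \<le> 2 * L2_dist2 f g + 2 * L2_dist2 f' g'"
proof -
  note int = integrable_L2_dist2[OF assms(1,2)] integrable_L2_dist2[OF assms(3,4)]
  have "L2_dist2 (\<lambda>x. f x + f' x) (\<lambda>x. g x + g' x)
      \<le> (\<integral>x. 2 * (cmod (f x - g x))\<^sup>2 + 2 * (cmod (f' x - g' x))\<^sup>2 \<partial>M)"
    unfolding L2_dist2_def
  proof (rule integral_mono)
    show "(cmod (f x + f' x - (g x + g' x)))\<^sup>2 \<le> 2 * (cmod (f x - g x))\<^sup>2 + 2 * (cmod (f' x - g' x))\<^sup>2" for x
      using norm_add_square_le[of "f x - g x" "f' x - g' x"] by (simp add: algebra_simps)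
    show "integrable M (\<lambda>x. (cmod (f x + f' x - (g x + g' x)))\<^sup>2)"
      by (intro integrable_L2_dist2 square_integrable_add assms)
  qed (use int in auto)
  also have "\<dots> = 2 * L2_dist2 f g + 2 * L2_dist2 f' g'"
    unfolding L2_dist2_def using int by simp
  finally show ?thesis .
qed

lemma L2_dist2_triangle:
  assumes "f \<in> square_integrable M" "g \<in> square_integrable M" "h \<in> square_integrable M"
  shows "L2_dist2 f h \<le> 2 * L2_dist2 f g + 2 * L2_dist2 g h"
  using L2_dist2_add_le[OF assms(1,2) assms(2,3)]
  by (simp add: L2_dist2_def algebra_simps)

lemma approximable_limit:
  assumes f: "f \<in> square_integrable M"
    and lim: "\<And>\<epsilon>. \<epsilon> > 0 \<Longrightarrow> \<exists>g. approximable g \<and> L2_dist2 f g < \<epsilon>"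
  shows "approximable f"
  unfolding approximable_def
proof (intro conjI allI impI f)
  fix \<epsilon> :: real assume "\<epsilon> > 0"
  then obtain g where g: "approximable g" "L2_dist2 f g < \<epsilon> / 4"
    using lim[of "\<epsilon> / 4"] by auto
  then obtain h where h: "h \<in> expo_span \<Lambda>" "L2_dist2 g h < \<epsilon> / 4"
    using \<open>\<epsilon> > 0\<close> unfolding approximable_def by (meson zero_less_divide_iff zero_less_numeral)
  have "L2_dist2 f h \<le> 2 * L2_dist2 f g + 2 * L2_dist2 g h"
    using f g h by (intro L2_dist2_triangle) (auto simp: approximable_def square_integrable_expo_span)
  also have "\<dots> < \<epsilon>"
    using g h by simp
  finally show "\<exists>g\<in>expo_span \<Lambda>. L2_dist2 f g < \<epsilon>"
    using h by blast
qed

lemma approximable_sequence: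
  assumes f: "f \<in> square_integrable M" and g: "\<And>n. approximable (g n)"
    and lim: "(\<lambda>n. L2_dist2 f (g n)) \<longlonglongrightarrow> 0"
  shows "approximable f"
proof (rule approximable_limit[OF f])
  fix \<epsilon> :: real assume "\<epsilon> > 0"
  hence "eventually (\<lambda>n. L2_dist2 f (g n) < \<epsilon>) sequentially"
    using lim by (intro order_tendstoD)
  thus "\<exists>g. approximable g \<and> L2_dist2 f g < \<epsilon>"
    using g by (auto simp: eventually_sequentially)
qed

lemma approximable_zero: "approximable (\<lambda>x. 0)"
  unfolding approximable_def L2_dist2_def
  by (auto intro!: bexI[OF _ expo_span.zero] simp: square_integrable_def)

lemma approximable_add:
  assumes f: "approximable f" and g: "approximable g"
  shows "approximable (\<lambda>x. f x + g x)"
  unfolding approximable_def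
proof (intro conjI allI impI)
  show "(\<lambda>x. f x + g x) \<in> square_integrable M"
    using f g by (intro square_integrable_add) (auto simp: approximable_def)
  fix \<epsilon> :: real assume "\<epsilon> > 0"
  hence "\<epsilon> / 4 > 0" by simp
  then obtain f' g' where f': "f' \<in> expo_span \<Lambda>" "L2_dist2 f f' < \<epsilon> / 4"
    and g': "g' \<in> expo_span \<Lambda>" "L2_dist2 g g' < \<epsilon> / 4"
    using f g unfolding approximable_def by meson
  have "L2_dist2 (\<lambda>x. f x + g x) (\<lambda>x. f' x + g' x) \<le> 2 * L2_dist2 f f' + 2 * L2_dist2 g g'"
    using f g f' g'
    by (intro L2_dist2_add_le) (auto simp: approximable_def square_integrable_expo_span)
  also have "\<dots> < \<epsilon>"
    using f' g' by simp
  finally show "\<exists>h\<in>expo_span \<Lambda>. L2_dist2 (\<lambda>x. f x + g x) h < \<epsilon>"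
    using expo_span.add[OF f'(1) g'(1)] by blast
qed

lemma approximable_cmult:
  assumes f: "approximable f"
  shows "approximable (\<lambda>x. c * f x)"
proof (cases "c = 0")
  case False
  show ?thesis
    unfolding approximable_def
  proof (intro conjI allI impI)
    show "(\<lambda>x. c * f x) \<in> square_integrable M"
      using f by (intro square_integrable_cmult) (auto simp: approximable_def)
    fix \<epsilon> :: real assume "\<epsilon> > 0"
    hence "\<epsilon> / (cmod c)\<^sup>2 > 0"
      using False by simp
    then obtain g where g: "g \<in> expo_span \<Lambda>" "L2_dist2 f g < \<epsilon> / (cmod c)\<^sup>2"
      using f unfolding approximable_def by meson
    have "L2_dist2 (\<lambda>x. c * f x) (\<lambda>x. c * g x) = (cmod c)\<^sup>2 * L2_dist2 f g"
      unfolding L2_dist2_def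
      by (simp add: norm_mult power_mult_distrib flip: right_diff_distrib)
    also have "\<dots> < \<epsilon>"
      using g False by (simp add: field_simps)
    finally show "\<exists>h\<in>expo_span \<Lambda>. L2_dist2 (\<lambda>x. c * f x) h < \<epsilon>"
      using expo_span_cmult[OF g(1)] by blast
  qed
qed (simp add: approximable_zero)

lemma approximable_sum:
  "(\<And>i. i \<in> I \<Longrightarrow> approximable (f i)) \<Longrightarrow> approximable (\<lambda>x. \<Sum>i\<in>I. f i x)"
  by (induction I rule: infinite_finite_induct) (auto simp: approximable_zero approximable_add)

context
  fixes R :: real
  assumes R: "AE x in M. \<bar>x\<bar> \<le> R"
    and dense: "\<And>\<xi>. approximable (expo \<xi>)"
begin

lemma approximable_expo_span: "f \<in> expo_span UNIV \<Longrightarrow> approximable f"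
  by (induction rule: expo_span.induct)
     (auto intro: approximable_zero approximable_add approximable_cmult dense)

lemma approximable_continuous:
  fixes g :: "real \<Rightarrow> real"
  assumes g: "continuous_on UNIV g" and K: "\<And>x. \<bar>g x\<bar> \<le> K"
  shows "approximable (\<lambda>x. of_real (g x))"
proof (rule approximable_limit)
  have [measurable]: "g \<in> borel_measurable borel"
    by (intro borel_measurable_continuous_onI g)
  show sq: "(\<lambda>x. complex_of_real (g x)) \<in> square_integrable M"
    by (rule square_integrable_bounded[where K = K]) (auto simp: K)
  fix \<epsilon> :: real assume e: "\<epsilon> > 0"
  \<comment> \<open>\<open>R\<close> may be 0, as for the point mass at 0, whereas the approximation
    asks for an interval of positive radius.\<close>
  define S where "S = max R 1"
  have "S > 0" "AE x in M. x \<in> {-S..S}"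
    using R by (auto simp: S_def elim!: eventually_mono)
  moreover have "sqrt (\<epsilon> / 2) > 0"
    using e by simp
  ultimately obtain f where f: "f \<in> expo_span UNIV"
    "\<And>x. x \<in> {-S..S} \<Longrightarrow> cmod (of_real (g x) - f x) < sqrt (\<epsilon> / 2)"
    using trig_approximation[OF continuous_on_subset[OF g]] by (metis subset_UNIV)
  have "L2_dist2 (\<lambda>x. of_real (g x)) f \<le> (\<integral>x. \<epsilon> / 2 \<partial>M)"
    unfolding L2_dist2_def
  proof (rule integral_mono_AE)
    show "AE x in M. (cmod (of_real (g x) - f x))\<^sup>2 \<le> \<epsilon> / 2"
      using \<open>AE x in M. x \<in> {-S..S}\<close>
    proof eventually_elim
      case (elim x)
      have "(cmod (of_real (g x) - f x))\<^sup>2 \<le> (sqrt (\<epsilon> / 2))\<^sup>2"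
        using f(2)[OF elim] by (intro power_mono) auto
      thus ?case
        using e by simp
    qed
    show "integrable M (\<lambda>x. (cmod (of_real (g x) - f x))\<^sup>2)"
      by (rule integrable_L2_dist2[OF sq square_integrable_expo_span[OF f(1)]])
  qed simp
  also have "\<dots> < \<epsilon>"
    using e by (simp add: prob_space)
  finally show "\<exists>h. approximable h \<and> L2_dist2 (\<lambda>x. of_real (g x)) h < \<epsilon>"
    using approximable_expo_span[OF f(1)] by blast
qed

lemma approximable_dominated:
  assumes f [measurable]: "f \<in> borel_measurable M" and g: "\<And>n. approximable (g n)"
    and lim: "\<And>x. (\<lambda>n. g n x) \<longlonglongrightarrow> f x"
    and w: "integrable M w" and bound: "\<And>n x. (cmod (f x - g n x))\<^sup>2 \<le> w x"
    and sq: "f \<in> square_integrable M"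
  shows "approximable f"
proof (rule approximable_sequence[OF sq g])
  have [measurable]: "g n \<in> borel_measurable M" for n
    using g by (auto simp: approximable_def square_integrable_def)
  have "(\<lambda>n. \<integral>x. (cmod (f x - g n x))\<^sup>2 \<partial>M) \<longlonglongrightarrow> (\<integral>x. 0 \<partial>M)"
  proof (rule integral_dominated_convergence[where w = w])
    show "AE x in M. (\<lambda>n. (cmod (f x - g n x))\<^sup>2) \<longlonglongrightarrow> 0"
    proof (rule AE_I2)
      fix x
      have "(\<lambda>n. (cmod (f x - g n x))\<^sup>2) \<longlonglongrightarrow> (cmod (f x - f x))\<^sup>2"
        by (intro tendsto_intros lim)
      thus "(\<lambda>n. (cmod (f x - g n x))\<^sup>2) \<longlonglongrightarrow> 0" by simp
    qed
  qed (use w bound in auto)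
  thus "(\<lambda>n. L2_dist2 f (g n)) \<longlonglongrightarrow> 0"
    by (simp add: L2_dist2_def)
qed

lemma approximable_indicator_atMost: "approximable (indicator {..a})"
proof -
  \<comment> \<open>For n > 0 a continuous ramp, equal to 1 up to \<open>a\<close> and falling
    linearly to 0 at a + 1/n.\<close>
  define g where "g n x = max 0 (min 1 (1 - real n * (x - a)))" for n x
  have g01: "0 \<le> g n x" "g n x \<le> 1" for n x
    by (auto simp: g_def)
  show ?thesis
  proof (rule approximable_dominated[where g = "\<lambda>n x. of_real (g n x)" and w = "\<lambda>_. 1"])
    show "approximable (\<lambda>x. of_real (g n x))" for n
      by (rule approximable_continuous[where K = 1])
         (use g01 in \<open>auto simp: g_def intro!: continuous_intros\<close>)
    show "(\<lambda>n. of_real (g n x)) \<longlonglongrightarrow> indicator {..a} x" for x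
    proof (cases "x \<le> a")
      case True
      hence "g n x = 1" for n
        by (auto simp: g_def mult_nonneg_nonpos)
      thus ?thesis
        using True by simp
    next
      case False
      hence "eventually (\<lambda>n. real n > 1 / (x - a)) sequentially"
        by (intro filterlim_at_top_dense[THEN iffD1, rule_format, OF filterlim_real_sequentially])
      hence "eventually (\<lambda>n. complex_of_real (g n x) = 0) sequentially"
        by eventually_elim (use False in \<open>auto simp: g_def field_simps\<close>)
      thus ?thesis
        using False by (auto intro: tendsto_eventually)
    qed
    show "(cmod (indicator {..a} x - of_real (g n x)))\<^sup>2 \<le> 1" for n x
    proof -
      have "cmod (indicator {..a} x - of_real (g n x)) \<le> 1"
      proof -
        have "indicator {..a} x - complex_of_real (g n x) = of_real (indicator {..a} x - g n x)"
          by (simp add: of_real_indicator)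
        hence "cmod (indicator {..a} x - of_real (g n x)) = \<bar>indicator {..a} x - g n x\<bar>"
          by (simp only: norm_of_real)
        also have "\<dots> \<le> 1"
          using g01[of n x] by (cases "x \<le> a") auto
        finally show ?thesis .
      qed
      thus ?thesis
        by (simp add: power_le_one)
    qed
    show "(indicator {..a} :: real \<Rightarrow> complex) \<in> square_integrable M"
      by (rule square_integrable_bounded[where K = 1]) (auto simp: indicator_def)
  qed auto
qed

text \<open>Half-lines are closed under intersection and generate the Borel sets, so a Dynkin
  induction applies: complements use the constant \<open>expo 0\<close>, disjoint unions use
  dominated convergence of finite unions.\<close>

lemma approximable_indicator:
  assumes "X \<in> sets borel"
  shows "approximable (indicator X)"
proof -
  have sq: "(indicator Y :: real \<Rightarrow> complex) \<in> square_integrable M" if [measurable]: "Y \<in> sets borel" for Y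
    by (rule square_integrable_bounded[where K = 1]) (auto simp: indicator_def)
  have eq: "sets borel = sigma_sets UNIV (range (\<lambda>a::real. {..a}))"
    by (subst borel_eq_atMost) simp
  have "Int_stable (range (\<lambda>a::real. {..a}))"
    by (auto simp: Int_stable_def)
  moreover have "range (\<lambda>a::real. {..a}) \<subseteq> Pow UNIV"
    by simp
  moreover have "X \<in> sigma_sets UNIV (range (\<lambda>a::real. {..a}))"
    using assms eq by simp
  ultimately show ?thesis
  proof (induction rule: sigma_sets_induct_disjoint)
    case (basic Y)
    thus ?case
      by (auto simp: approximable_indicator_atMost)
  next
    case empty
    thus ?case
      using approximable_zero by (simp add: indicator_def)
  next
    case (compl Y)
    have "approximable (\<lambda>x. expo 0 x + (-1) * indicator Y x)"
      by (intro approximable_add approximable_cmult dense compl)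
    moreover have "(\<lambda>x. expo 0 x + (-1) * indicator Y x) = indicator (UNIV - Y)"
      by (auto simp: fun_eq_iff indicator_def)
    ultimately show ?case by simp
  next
    case (union Y)
    have Y [measurable]: "Y i \<in> sets borel" for i
      using union eq by auto
    show ?case
    proof (rule approximable_dominated[where g = "\<lambda>n. indicator (\<Union>i<n. Y i)" and w = "\<lambda>_. 1"])
      show "approximable (indicator (\<Union>i<n. Y i))" for n
      proof -
        have "indicator (\<Union>i<n. Y i) = (\<lambda>x. \<Sum>i<n. indicator (Y i) x :: complex)"
          using union(1)
          by (intro ext indicator_UN_disjoint) (auto simp: disjoint_family_on_def)
        thus ?thesis
          using union by (simp add: approximable_sum)
      qed
      show "(\<lambda>n. indicator (\<Union>i<n. Y i) x) \<longlonglongrightarrow> (indicator (\<Union>i. Y i) x :: complex)" for x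
        by (rule LIMSEQ_indicator_UN)
      show "(cmod (indicator (\<Union>i. Y i) x - indicator (\<Union>i<n. Y i) x))\<^sup>2 \<le> 1" for n x
        by (auto simp: indicator_def)
      show "(indicator (\<Union>i. Y i) :: real \<Rightarrow> complex) \<in> square_integrable M"
        by (rule sq) measurable
    qed auto
  qed
qed

lemma approximable_square_integrable:
  assumes f: "f \<in> square_integrable M"
  shows "approximable f"
proof -
  have f_meas [measurable]: "f \<in> borel_measurable M"
    using f by (rule square_integrable_measurable)
  have space: "space M = UNIV"
    using sets_eq_imp_space_eq[OF M(2)] by simp
  obtain s where s: "\<And>i. simple_function M (s i)" "\<And>x. (\<lambda>i. s i x) \<longlonglongrightarrow> f x"
    "\<And>i x. dist (s i x) 0 \<le> 2 * dist (f x) 0"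
    using borel_measurable_implies_sequence_metric[OF f_meas, of 0] by (auto simp: space)
  show ?thesis
  proof (rule approximable_dominated[OF f_meas _ s(2)])
    show "approximable (s i)" for i
    proof -
      have "approximable (\<lambda>x. \<Sum>y\<in>range (s i). y * indicator (s i -` {y}) x)"
        using simple_functionD(2)[OF s(1), of i] M(2)
        by (intro approximable_sum approximable_cmult approximable_indicator) (auto simp: space)
      moreover have "s i = (\<lambda>x. \<Sum>y\<in>range (s i). y * indicator (s i -` {y}) x)"
      proof
        fix x
        have "s i x = (\<Sum>y\<in>range (s i). indicator (s i -` {y}) x *\<^sub>R y)"
          using simple_function_indicator_representation_banach[OF s(1)[of i], of x]
          unfolding space Int_UNIV_right by blast
        also have "\<dots> = (\<Sum>y\<in>range (s i). y * indicator (s i -` {y}) x)"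
          by (intro sum.cong) (simp_all add: scaleR_conv_of_real of_real_indicator)
        finally show "s i x = (\<Sum>y\<in>range (s i). y * indicator (s i -` {y}) x)" .
      qed
      ultimately show ?thesis by metis
    qed
    \<comment> \<open>The simple functions satisfy |s| <= 2 |f|, so |f - s| <= 3 |f|, whence the
      factor 9.\<close>
    show "integrable M (\<lambda>x. 9 * (cmod (f x))\<^sup>2)"
      using f by (simp add: square_integrable_def)
    show "(cmod (f x - s i x))\<^sup>2 \<le> 9 * (cmod (f x))\<^sup>2" for i x
    proof -
      have "cmod (f x - s i x) \<le> 3 * cmod (f x)"
        using norm_triangle_ineq4[of "f x" "s i x"] s(3)[of i x] by simp
      hence "(cmod (f x - s i x))\<^sup>2 \<le> (3 * cmod (f x))\<^sup>2"
        by (intro power_mono) auto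
      thus ?thesis
        by (simp add: power_mult_distrib)
    qed
  qed (rule f)
qed

end

text \<open>One minus the sum in \<open>complete\<close> is the squared error of the best
  approximation of \<open>expo \<xi>\<close> from \<open>F\<close>. So every exponential is
  approximable, and by bounded support every square integrable function is.\<close>

lemma is_spectrumI:
  assumes R: "AE x in M. \<bar>x\<bar> \<le> R"
    and orth: "\<And>s t. s \<in> \<Lambda> \<Longrightarrow> t \<in> \<Lambda> \<Longrightarrow> s \<noteq> t \<Longrightarrow> fourier_transform M (s - t) = 0"
    and complete: "\<And>\<xi> \<eta>. \<eta> > 0 \<Longrightarrow> \<exists>F. finite F \<and> F \<subseteq> \<Lambda> \<and>
      (\<Sum>s\<in>F. (cmod (fourier_transform M (\<xi> - s)))\<^sup>2) > 1 - \<eta>"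
  shows "is_spectrum M \<Lambda>"
proof -
  have expo: "approximable (expo \<xi>)" for \<xi>
    unfolding approximable_def
  proof (intro conjI allI impI)
    show "expo \<xi> \<in> square_integrable M"
      by (rule expo_square_integrable[OF M])
    fix \<epsilon> :: real assume "\<epsilon> > 0"
    then obtain F where F: "finite F" "F \<subseteq> \<Lambda>"
      "(\<Sum>s\<in>F. (cmod (fourier_transform M (\<xi> - s)))\<^sup>2) > 1 - \<epsilon>"
      using complete by blast
    define g where "g x = (\<Sum>s\<in>F. fourier_transform M (\<xi> - s) * expo s x)" for x
    have "L2_dist2 (expo \<xi>) g = (L2_norm M (\<lambda>x. expo \<xi> x - g x))\<^sup>2"
      by (simp add: L2_dist2_def L2_norm_def)
    also have "\<dots> = 1 - (\<Sum>s\<in>F. (cmod (fourier_transform M (\<xi> - s)))\<^sup>2)"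
      unfolding g_def using F orth by (subst L2_norm_expo_expansion[OF M F(1)]) auto
    also have "\<dots> < \<epsilon>"
      using F by simp
    finally have "L2_dist2 (expo \<xi>) g < \<epsilon>" .
    moreover have "g \<in> expo_span \<Lambda>"
      unfolding g_def using F(1,2)
      by (induction F rule: finite_induct) (auto intro: expo_span.intros)
    ultimately show "\<exists>g\<in>expo_span \<Lambda>. L2_dist2 (expo \<xi>) g < \<epsilon>"
      by blast
  qed
  show ?thesis
    unfolding is_spectrum_def orthogonal_basis_L2_def
  proof (intro conjI ballI allI impI)
    fix f and \<epsilon> :: real assume f: "f \<in> square_integrable M" and e: "\<epsilon> > 0"
    have "approximable f"
      by (rule approximable_square_integrable[OF R expo f])
    then obtain g where g: "g \<in> expo_span \<Lambda>" "L2_dist2 f g < \<epsilon>\<^sup>2"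
      using e unfolding approximable_def by (meson zero_less_power)
    have "L2_norm M (\<lambda>x. f x - g x) = sqrt (L2_dist2 f g)"
      by (simp add: L2_norm_def L2_dist2_def)
    also have "\<dots> < \<epsilon>"
      using g e by (metis real_sqrt_less_mono real_sqrt_abs abs_of_pos)
    finally show "\<exists>F c. finite F \<and> F \<subseteq> \<Lambda> \<and> L2_norm M (\<lambda>x. f x - (\<Sum>i\<in>F. c i * expo i x)) < \<epsilon>"
      using expo_span_explicit[OF g(1)] by blast
  qed (simp_all add: expo_square_integrable L2_norm_expo L2_inner_expo orth M)
qed

end

subsection \<open>The masks of the digit sets\<close>

lemma isCont_trig_mean: "isCont (trig_mean C) x"
proof -
  have "continuous_on UNIV (trig_mean C)"
    unfolding trig_mean_def[abs_def] by (cases "card C = 0") (auto intro!: continuous_intros)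
  thus ?thesis
    by (simp add: continuous_on_eq_continuous_at)
qed

text \<open>All digits acquire the same phase under translation by \<open>h\<close>, and the modulus
  forgets it.\<close>

lemma norm_trig_mean_shift:
  assumes C: "finite C" and h: "\<And>c d. c \<in> C \<Longrightarrow> d \<in> C \<Longrightarrow> of_int (c - d) * h \<in> \<int>"
  shows "cmod (trig_mean C (x + h)) = cmod (trig_mean C x)"
proof (cases "C = {}")
  case False
  then obtain d where d: "d \<in> C" by blast
  have "expo (of_int c) (x + h) = expo (of_int d) h * expo (of_int c) x" if "c \<in> C" for c
  proof -
    have "expo (of_int c) h = expo (of_int d) h"
      using h[OF that d] by (subst expo_eq_expo_iff) simp
    thus ?thesis
      by (simp add: expo_add_right mult.commute)
  qed
  hence "trig_mean C (x + h) = expo (of_int d) h * trig_mean C x"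
    by (simp add: trig_mean_def sum_distrib_left)
  thus ?thesis
    by (simp add: norm_mult)
qed (simp add: trig_mean_def)

lemma trig_mean_dilation:
  "q \<noteq> 0 \<Longrightarrow> trig_mean ((\<lambda>c. q * c) ` C) x = trig_mean C (of_int q * x)"
  by (simp add: trig_mean_def sum.reindex card_image inj_on_def)
     (simp add: expo_eq_cis mult_ac)

lemma trig_mean_direct_sum:
  assumes sum: "is_direct_sum I S B" and I: "finite I" and S: "\<And>i. i \<in> I \<Longrightarrow> finite (S i)"
  shows "trig_mean B x = (\<Prod>i\<in>I. trig_mean (S i) x)"
proof -
  have B: "B = (\<lambda>f. \<Sum>i\<in>I. f i) ` PiE I S"
    using sum by (auto simp: is_direct_sum_def)
  have inj: "inj_on (\<lambda>f. \<Sum>i\<in>I. f i) (PiE I S)"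
    using sum unfolding is_direct_sum_def inj_on_def by blast
  have "(\<Sum>b\<in>B. expo (of_int b) x) = (\<Sum>f\<in>PiE I S. \<Prod>i\<in>I. expo (of_int (f i)) x)"
    unfolding B sum.reindex[OF inj] by (simp add: expo_sum_left)
  also have "\<dots> = (\<Prod>i\<in>I. \<Sum>c\<in>S i. expo (of_int c) x)"
    using I S by (rule prod_sum_PiE[symmetric])
  finally have "(\<Sum>b\<in>B. expo (of_int b) x) = (\<Prod>i\<in>I. \<Sum>c\<in>S i. expo (of_int c) x)" .
  moreover have "card B = (\<Prod>i\<in>I. card (S i))"
    unfolding B card_image[OF inj] by (rule card_PiE[OF I])
  ultimately show ?thesis
    by (simp add: trig_mean_def prod_dividef)
qed

lemma prod_eq_1_unit_interval:
  fixes f :: "'a \<Rightarrow> real"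
  assumes I: "finite I" and f: "\<And>i. i \<in> I \<Longrightarrow> 0 \<le> f i" "\<And>i. i \<in> I \<Longrightarrow> f i \<le> 1"
    and 1: "(\<Prod>i\<in>I. f i) = 1" and i: "i \<in> I"
  shows "f i = 1"
proof -
  have "1 = f i * (\<Prod>j\<in>I - {i}. f j)"
    using 1 I i by (simp add: prod.remove)
  also have "\<dots> \<le> f i * 1"
    using f i by (intro mult_left_mono prod_le_1) auto
  finally show ?thesis
    using f(2)[OF i] by simp
qed

section \<open>Rescaled masks of the digit sets and the factor left over by moving levels\<close>

locale digit_masks =
  fixes a :: int and p :: nat and n :: "nat \<Rightarrow> nat" and C :: "nat \<Rightarrow> int set"
  assumes a_ge_2: "a \<ge> 2" and p_pos: "p > 0"
    and C: "k < p \<Longrightarrow> finite (C k)" "k < p \<Longrightarrow> C k \<noteq> {}"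
    and parseval: "k < p \<Longrightarrow> \<exists>L::int set. finite L \<and>
      (\<forall>x. (\<Sum>l\<in>L. (cmod (trig_mean (C k) (x + of_int l / of_int a)))\<^sup>2) = 1)"
begin

definition differences :: "int set" where
  "differences = {c - d | k c d. k < p \<and> c \<in> C k \<and> d \<in> C k}"

text \<open>The gcd is 0 exactly when every digit set is a singleton; the value 1 keeps the division
  meaningful in that case, which \<open>w_trivial\<close> handles.\<close>

definition scale :: int where
  "scale = (if Gcd differences = 0 then 1 else Gcd differences)"

text \<open>After division by \<open>scale\<close> only differences of digits have integer
  frequencies, so it is the modulus that is 1-periodic. Reducing the index modulo \<open>p\<close>
  lets a mask be numbered by the power of \<open>a\<close> that multiplies its argument.\<close>

definition u :: "nat \<Rightarrow> real \<Rightarrow> real" where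
  "u k x = cmod (trig_mean (C (k mod p)) (x / of_int scale))"

definition w :: "real \<Rightarrow> real" where
  "w x = (\<Prod>k<p. u k (of_int a ^ k * x))"

text \<open>The constant 1, with spectrum {0}, fills the positions without a leftover mask, so that
  consecutive powers of \<open>a\<close> occur as in
  \<open>parseval_dilated_product\<close>.\<close>

definition v :: "nat \<Rightarrow> real \<Rightarrow> real" where
  "v j x = (if j div p < n (j mod p) then u j x else 1)"

text \<open>
  The factors of the transform of \<open>B\<close> that are left over when its \<open>k\<close>-th digit set is moved
  from level \<open>n k * p + k\<close> down to level \<open>k\<close>.
\<close>

definition W :: "real \<Rightarrow> real" where
  "W x = (\<Prod>j<p * sum n {..<p}. v j (of_int a ^ j * x))"

lemma a_pos [simp]: "a > 0" "real_of_int a > 0" "a \<noteq> 0" "real_of_int a \<ge> 0"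
  using a_ge_2 by auto

lemma scale_pos [simp]: "scale > 0" "real_of_int scale > 0" "scale \<noteq> 0"
proof -
  have "scale > 0"
    by (auto simp: scale_def less_le)
  thus "scale > 0" "real_of_int scale > 0" "scale \<noteq> 0" by auto
qed

lemma scale_dvd: "e \<in> differences \<Longrightarrow> scale dvd e"
  by (auto simp: scale_def)

lemma Cmod: "finite (C (k mod p))" "C (k mod p) \<noteq> {}"
  using C p_pos by auto

lemma u_nonneg: "0 \<le> u k x" and u_le_1: "u k x \<le> 1" and u_at_0: "u k 0 = 1"
  by (auto simp: u_def norm_trig_mean_le_1 Cmod)

lemma isCont_u: "isCont (u k) x"
  unfolding u_def[abs_def]
  by (intro continuous_intros isCont_o2[OF _ isCont_trig_mean]) auto

lemma difference_in_differences:
  "c \<in> C (k mod p) \<Longrightarrow> d \<in> C (k mod p) \<Longrightarrow> c - d \<in> differences"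
  using mod_less_divisor[OF p_pos] unfolding differences_def by blast

lemma u_periodic: "u k (x + of_int m) = u k x"
  unfolding u_def add_divide_distrib
proof (rule norm_trig_mean_shift[OF Cmod(1)])
  fix c d assume "c \<in> C (k mod p)" "d \<in> C (k mod p)"
  then obtain e where "c - d = scale * e"
    by (meson scale_dvd difference_in_differences dvdE)
  hence "of_int (c - d) * (of_int m / of_int scale) = (of_int (e * m) :: real)"
    by simp
  thus "of_int (c - d) * (of_int m / of_int scale) \<in> (\<int> :: real set)"
    by (metis Ints_of_int)
qed

lemma u_parseval: "\<exists>L::int set. finite L \<and> (\<forall>x. (\<Sum>l\<in>L. (u k (x + of_int l / of_int a))\<^sup>2) = 1)"
proof -
  obtain L :: "int set" where L: "finite L"
    "\<And>x. (\<Sum>l\<in>L. (cmod (trig_mean (C (k mod p)) (x + of_int l / of_int a)))\<^sup>2) = 1"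
    using parseval[of "k mod p"] p_pos by auto
  have "(x + of_int (scale * l) / of_int a) / of_int scale = x / of_int scale + of_int l / of_int a"
    for x :: real and l
    by (simp add: add_divide_distrib)
  hence "(\<Sum>l\<in>(\<lambda>l. scale * l) ` L. (u k (x + of_int l / of_int a))\<^sup>2) = 1" for x
    by (subst sum.reindex) (auto simp: inj_on_def u_def L(2))
  thus ?thesis
    using L(1) by (intro exI[of _ "(\<lambda>l. scale * l) ` L"]) auto
qed

lemma u_lipschitz: "\<exists>K\<ge>0. \<forall>x y. \<bar>u k x - u k y\<bar> \<le> K * \<bar>x - y\<bar>"
proof -
  obtain K where K: "\<And>x y. \<bar>cmod (trig_mean (C (k mod p)) x) - cmod (trig_mean (C (k mod p)) y)\<bar>
      \<le> K * \<bar>x - y\<bar>"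
    using trig_mean_lipschitz by blast
  have "K \<ge> 0"
    using order_trans[OF abs_ge_zero K[of 1 0]] by simp
  have "\<bar>u k x - u k y\<bar> \<le> K / of_int scale * \<bar>x - y\<bar>" for x y
    using K[of "x / of_int scale" "y / of_int scale"]
    by (simp add: u_def abs_divide abs_of_pos[OF scale_pos(2)] flip: diff_divide_distrib)
  thus ?thesis
    using \<open>K \<ge> 0\<close> by (intro exI[of _ "K / of_int scale"]) (auto intro!: divide_nonneg_pos)
qed

lemma w_lipschitz: "\<exists>K. \<forall>x y. \<bar>w x - w y\<bar> \<le> K * \<bar>x - y\<bar>"
proof -
  obtain K where K: "\<And>k x y. \<bar>u k x - u k y\<bar> \<le> K k * \<bar>x - y\<bar>"
    using u_lipschitz by metis
  have "\<bar>w x - w y\<bar> \<le> (\<Sum>k<p. K k * of_int a ^ k) * \<bar>x - y\<bar>" for x y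
  proof -
    have "\<bar>w x - w y\<bar> \<le> (\<Sum>k<p. \<bar>u k (of_int a ^ k * x) - u k (of_int a ^ k * y)\<bar>)"
      unfolding w_def
      using norm_prod_diff[of "{..<p}" "\<lambda>k. u k (of_int a ^ k * x)" "\<lambda>k. u k (of_int a ^ k * y)"]
      by (simp add: u_nonneg u_le_1 abs_of_nonneg)
    also have "\<dots> \<le> (\<Sum>k<p. K k * \<bar>of_int a ^ k * x - of_int a ^ k * y\<bar>)"
      by (intro sum_mono K)
    also have "\<dots> = (\<Sum>k<p. K k * of_int a ^ k) * \<bar>x - y\<bar>"
    proof -
      have "\<bar>of_int a ^ k * x - of_int a ^ k * y\<bar> = of_int a ^ k * \<bar>x - y\<bar>" for k
        using abs_of_pos[OF zero_less_power[OF a_pos(2), of k]]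
        by (simp only: right_diff_distrib [symmetric] abs_mult)
      thus ?thesis
        by (simp add: sum_distrib_right mult.assoc)
    qed
    finally show ?thesis .
  qed
  thus ?thesis by blast
qed

lemma power_a_p: "real_of_int (a ^ p) = of_int a ^ p"
  by simp

lemma low_pass: "\<exists>K. low_pass_filter (a ^ p) w K"
proof -
  obtain K where K: "\<And>x y. \<bar>w x - w y\<bar> \<le> K * \<bar>x - y\<bar>"
    using w_lipschitz by blast
  have "low_pass_filter (a ^ p) w K"
  proof
    show "2 \<le> a ^ p"
      using self_le_power[of a p] a_ge_2 p_pos by simp
    show "w (x + of_int m) = w x" for x m
    proof -
      have "of_int a ^ k * (x + of_int m) = of_int a ^ k * x + of_int (a ^ k * m)" for k
        by (simp add: algebra_simps)
      thus ?thesis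
        unfolding w_def by (simp only: u_periodic)
    qed
  qed (auto simp: w_def u_nonneg u_le_1 u_at_0 intro!: prod_nonneg prod_le_1 K[unfolded w_def])
  thus ?thesis ..
qed

lemma finite_w_zeros: "finite {x \<in> {0..<1}. w x = 0}"
proof -
  have "{x \<in> {0..<1}. w x = 0} \<subseteq> (\<Union>k<p. (\<lambda>y. y * of_int scale / of_int a ^ k) `
      {y \<in> {0..<of_int a ^ k}. trig_mean (C k) y = 0})"
  proof
    fix x assume "x \<in> {x \<in> {0..<1}. w x = 0}"
    then obtain k where k: "0 \<le> x" "x < 1" "k < p" "trig_mean (C k) (of_int a ^ k * x / of_int scale) = 0"
      by (auto simp: w_def u_def)
    let ?y = "of_int a ^ k * x / of_int scale"
    have "of_int a ^ k * x < of_int a ^ k * 1"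
      using k(2) by (intro mult_strict_left_mono) auto
    also have "\<dots> \<le> of_int a ^ k * of_int scale"
    proof (rule mult_left_mono)
      show "1 \<le> real_of_int scale"
        using scale_pos(1) by linarith
      show "0 \<le> real_of_int a ^ k"
        by (rule zero_le_power[OF a_pos(4)])
    qed
    finally have "?y < of_int a ^ k"
      by (simp add: field_simps)
    moreover have "0 \<le> ?y"
      using k(1) by (intro divide_nonneg_pos mult_nonneg_nonneg zero_le_power a_pos scale_pos)
    moreover have "x = ?y * of_int scale / of_int a ^ k"
      by simp
    ultimately show "x \<in> (\<Union>k<p. (\<lambda>y. y * of_int scale / of_int a ^ k) `
      {y \<in> {0..<of_int a ^ k}. trig_mean (C k) y = 0})"
      using k by (intro UN_I[of k] image_eqI[of _ _ ?y]) auto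
  qed
  thus ?thesis
    by (rule finite_subset) (intro finite_UN_I finite_imageI finite_trig_mean_zeros finite_lessThan C; simp)
qed

lemma w_parseval:
  "\<exists>L::int set. finite L \<and> 0 \<in> L \<and> (\<forall>x. (\<Sum>l\<in>L. (w (x + of_int l / of_int (a ^ p)))\<^sup>2) = 1)"
proof -
  have "\<exists>L::int set. finite L \<and>
    (\<forall>x. (\<Sum>l\<in>L. (\<Prod>j<p. u j (of_int a ^ j * (x + of_int l / of_int a ^ p)))\<^sup>2) = 1)"
    by (rule parseval_dilated_product) (use u_parseval in \<open>auto simp: u_at_0 u_periodic\<close>)
  then obtain L :: "int set" where L: "finite L" "\<And>x. (\<Sum>l\<in>L. (w (x + of_int l / of_int (a ^ p)))\<^sup>2) = 1"
    unfolding w_def power_a_p by blast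
  \<comment> \<open>A translate of the index set satisfies the same identity for all
    \<open>x\<close>; one through 0 is chosen because the nesting of the levels relies on the digit
    0.\<close>
  have "L \<noteq> {}"
    using L(2)[of 0] by auto
  then obtain m where m: "m \<in> L" by blast
  have "(\<Sum>l\<in>(\<lambda>l. l - m) ` L. (w (x + of_int l / of_int (a ^ p)))\<^sup>2) = 1" for x
    using L(2)[of "x - of_int m / of_int (a ^ p)"]
    by (subst sum.reindex) (auto simp: inj_on_def diff_divide_distrib algebra_simps)
  thus ?thesis
    using L(1) m by (intro exI[of _ "(\<lambda>l. l - m) ` L"]) auto
qed

lemma v_parseval: "\<exists>L::int set. finite L \<and> (\<forall>x. (\<Sum>l\<in>L. (v j (x + of_int l / of_int a))\<^sup>2) = 1)"
proof (cases "j div p < n (j mod p)")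
  case True
  thus ?thesis
    using u_parseval[of j] by (simp add: v_def)
next
  case False
  thus ?thesis
    by (intro exI[of _ "{0}"]) (simp add: v_def)
qed

lemma v_unit: "0 \<le> v j x" "v j x \<le> 1" "v j 0 = 1" "v j (x + of_int m) = v j x"
  by (auto simp: v_def u_nonneg u_le_1 u_at_0 u_periodic)

lemma isCont_v: "isCont (v j) x"
  unfolding v_def[abs_def] by (cases "j div p < n (j mod p)") (simp_all add: isCont_u)

lemma W_unit: "0 \<le> W x" "W x \<le> 1" "W 0 = 1"
  by (auto simp: W_def v_unit intro!: prod_nonneg prod_le_1)

lemma W_periodic: "W (x + of_int m) = W x"
proof -
  have "of_int a ^ k * (x + of_int m) = of_int a ^ k * x + of_int (a ^ k * m)" for k
    by (simp add: algebra_simps)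
  thus ?thesis
    unfolding W_def by (simp only: v_unit)
qed

lemma isCont_W: "isCont W x"
  unfolding W_def[abs_def] by (intro continuous_intros isCont_o2[OF _ isCont_v])

lemma W_parseval: "\<exists>\<Gamma>. finite \<Gamma> \<and> (\<forall>x. (\<Sum>g\<in>\<Gamma>. (W (x + g))\<^sup>2) = 1)"
proof -
  let ?N = "p * sum n {..<p}"
  have "\<exists>L::int set. finite L \<and>
    (\<forall>x. (\<Sum>l\<in>L. (\<Prod>j<?N. v j (of_int a ^ j * (x + of_int l / of_int a ^ ?N)))\<^sup>2) = 1)"
    by (rule parseval_dilated_product) (use v_parseval in \<open>auto simp: v_unit\<close>)
  then obtain L :: "int set" where L: "finite L" "\<And>x. (\<Sum>l\<in>L. (W (x + of_int l / of_int a ^ ?N))\<^sup>2) = 1"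
    unfolding W_def by blast
  show ?thesis
    using L(1) parseval_image[where V = W, OF L(1) W_unit(3) L(2)]
    by (intro exI[of _ "(\<lambda>l. of_int l / of_int a ^ ?N) ` L"]) auto
qed

lemma W_eq: "W x = (\<Prod>k<p. \<Prod>i<n k. u k (of_int a ^ (k + i * p) * x))"
proof -
  let ?J = "{j. j < p * sum n {..<p} \<and> j div p < n (j mod p)}"
  have "W x = (\<Prod>j\<in>?J. u j (of_int a ^ j * x))"
    unfolding W_def v_def by (simp add: prod.If_cases Int_def)
  also have "\<dots> = (\<Prod>(k, i)\<in>(SIGMA k:{..<p}. {..<n k}). u k (of_int a ^ (k + i * p) * x))"
  proof (rule prod.reindex_bij_witness[where i = "\<lambda>(k, i). k + i * p" and j = "\<lambda>j. (j mod p, j div p)"])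
    fix q assume "q \<in> (SIGMA k:{..<p}. {..<n k})"
    then obtain k i where q: "q = (k, i)" "k < p" "i < n k" by auto
    \<comment> \<open>The length p * sum n is a crude bound that exceeds every leftover position k +
      i p with i < n k.\<close>
    have "n k \<le> sum n {..<p}"
      using q by (intro member_le_sum) auto
    hence "Suc i * p \<le> sum n {..<p} * p"
      using q by (intro mult_right_mono) auto
    hence "k + i * p < p * sum n {..<p}"
      using q by (simp add: mult.commute)
    thus "(case q of (k, i) \<Rightarrow> k + i * p) \<in> ?J"
      using q by simp
  qed (use p_pos in \<open>auto simp: u_def\<close>)
  also have "\<dots> = (\<Prod>k<p. \<Prod>i<n k. u k (of_int a ^ (k + i * p) * x))"
    by (subst prod.Sigma) auto
  finally show ?thesis .
qed

text \<open>Telescoping in \<open>i\<close>: relative to the argument x / A, \<open>W x\<close>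
  contributes the indices 1, ..., n k and the mask \<open>w\<close> the index 0. Splitting off the
  top index n k instead leaves 0, ..., n k - 1, which is \<open>W\<close> at x / A.\<close>

lemma W_refinement:
  "W x * w (x / of_int (a ^ p)) =
    (\<Prod>k<p. u k (of_int a ^ (n k * p + k) * (x / of_int (a ^ p)))) * W (x / of_int (a ^ p))"
proof -
  define g where "g k i = u k (of_int a ^ (k + i * p) * (x / of_int (a ^ p)))" for k i
  have "of_int a ^ (k + Suc i * p) * (x / of_int (a ^ p)) = of_int a ^ (k + i * p) * x" for k i
    by (simp add: power_add)
  hence W: "W x = (\<Prod>k<p. \<Prod>i<n k. g k (Suc i))"
    unfolding W_eq g_def by simp
  have w: "w (x / of_int (a ^ p)) = (\<Prod>k<p. g k 0)"
    by (simp add: w_def g_def)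
  have "W x * w (x / of_int (a ^ p)) = (\<Prod>k<p. (\<Prod>i<n k. g k (Suc i)) * g k 0)"
    by (simp only: W w prod.distrib)
  also have "\<dots> = (\<Prod>k<p. \<Prod>i<Suc (n k). g k i)"
    unfolding prod.lessThan_Suc_shift by (simp add: mult.commute)
  also have "\<dots> = (\<Prod>k<p. g k (n k)) * (\<Prod>k<p. \<Prod>i<n k. g k i)"
    by (simp add: prod.distrib mult.commute)
  also have "(\<Prod>k<p. \<Prod>i<n k. g k i) = W (x / of_int (a ^ p))"
    unfolding W_eq g_def ..
  finally show ?thesis
    by (simp add: g_def add.commute)
qed

text \<open>
  If \<open>w z = 1\<close> then every \<open>a ^ k * z * e / scale\<close> with a difference \<open>e\<close> of \<open>C k\<close> is an integer;
  periodicity of \<open>z\<close> under multiplication by \<open>a ^ p\<close> removes the factor \<open>a ^ k\<close>, and since the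
  numbers \<open>e / scale\<close> have greatest common divisor 1, \<open>z\<close> is an integer.
\<close>

lemma periodic_point_integer:
  assumes gcd: "Gcd differences \<noteq> 0" and wz: "w z = 1" and R: "R > 0"
    and z: "(of_int (a ^ p) ^ R - 1) * z \<in> \<int>"
  shows "z \<in> \<int>"
proof -
  have scale: "scale = Gcd differences"
    using gcd by (simp add: scale_def)
  obtain s where s: "(of_int (a ^ p) ^ R - 1) * z = of_int s"
    using z by (auto elim: Ints_cases)
  define q where "q = (a ^ p) ^ R - 1"
  have "q > 0"
    using self_le_power[of a "p * R"] a_ge_2 p_pos R by (simp add: q_def flip: power_mult)
  have qz: "of_int q * z = of_int s"
    using s by (simp add: q_def)
  have "q * scale dvd s * e" if e_in: "e \<in> differences" for e
  proof -
    obtain k c d where e: "e = c - d" "k < p" "c \<in> C k" "d \<in> C k"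
      using e_in unfolding differences_def by blast
    obtain f where f: "e = scale * f"
      using scale_dvd[OF e_in] by (auto elim: dvdE)
    have "u k (of_int a ^ k * z) = 1"
      using prod_eq_1_unit_interval[of "{..<p}" "\<lambda>k. u k (of_int a ^ k * z)" k] wz e(2)
      by (auto simp: w_def u_nonneg u_le_1)
    hence "cmod (trig_mean (C k) (of_int a ^ k * z / of_int scale)) = 1"
      using e(2) by (simp add: u_def)
    hence "of_int e * (of_int a ^ k * z / of_int scale) \<in> \<int>"
      unfolding e(1) by (rule trig_mean_extremal[OF C(1)[OF e(2)] _ e(3,4)])
    moreover have "of_int e * (of_int a ^ k * z / of_int scale) = of_int f * (of_int a ^ k * z)"
      by (simp add: f)
    ultimately have "of_int f * (of_int a ^ k * z) \<in> \<int>"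
      by (simp only:)
    \<comment> \<open>This completes a^k to A^R, and A^R z differs from z by the integer
      \<open>s\<close>.\<close>
    hence "of_int (a ^ (p * R - k)) * (of_int f * (of_int a ^ k * z)) \<in> \<int>"
      by (rule Ints_mult[OF Ints_of_int])
    moreover have "k \<le> p * R"
      using e(2) R by (cases R) auto
    hence "real_of_int (a ^ (p * R - k)) * of_int a ^ k = of_int (a ^ p) ^ R"
      by (simp add: power_mult flip: power_add)
    hence "of_int (a ^ (p * R - k)) * (of_int f * (of_int a ^ k * z)) = of_int f * (of_int (a ^ p) ^ R * z)"
      by (metis (no_types, opaque_lifting) mult.assoc mult.commute)
    also have "\<dots> = of_int (f * s) + of_int f * z"
      using s by (simp add: algebra_simps)
    ultimately have "of_int (f * s) + of_int f * z - of_int (f * s) \<in> \<int>"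
      by (metis Ints_diff Ints_of_int)
    then obtain m where m: "of_int f * z = of_int m"
      by (auto elim: Ints_cases)
    have "of_int (s * e) = (of_int q * z) * (of_int scale * of_int f :: real)"
      by (simp add: qz f)
    also have "\<dots> = of_int (q * scale * m)"
      using m by (simp add: mult_ac)
    finally have "s * e = q * scale * m"
      by (simp only: of_int_eq_iff)
    thus ?thesis by simp
  qed
  \<comment> \<open>What divides s e for all differences e divides s times their gcd; cancelling
    \<open>scale\<close> gives q dvd s, so z = s / q is an integer.\<close>
  hence "q * scale dvd Gcd ((*) s ` differences)"
    by (intro Gcd_greatest) auto
  hence "q * scale dvd s * scale"
    by (simp add: Gcd_mult scale)
  hence "q dvd s"
    by simp
  then obtain m where "s = q * m" by (auto elim: dvdE)
  hence "of_int q * z = of_int q * of_int m"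
    by (simp add: qz)
  hence "z = of_int m"
    using \<open>q > 0\<close> by simp
  thus ?thesis by simp
qed

lemma w_trivial:
  assumes "Gcd differences = 0"
  shows "w x = 1"
proof -
  have "u k (of_int a ^ k * x) = 1" for k
  proof -
    have "of_int (c - d) * (of_int a ^ k * x / of_int scale) \<in> \<int>"
      if "c \<in> C (k mod p)" "d \<in> C (k mod p)" for c d
      using difference_in_differences[OF that] assms by (auto simp: Gcd_0_iff)
    hence "cmod (trig_mean (C (k mod p)) (0 + of_int a ^ k * x / of_int scale)) =
        cmod (trig_mean (C (k mod p)) 0)"
      by (rule norm_trig_mean_shift[OF Cmod(1)])
    thus ?thesis
      by (simp add: u_def Cmod)
  qed
  thus ?thesis
    by (simp add: w_def)
qed

text \<open>\<open>f\<close> stands for the modulus of the transform of the invariant measure. The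
  three assumed properties determine it, which keeps this argument free of measure theory.\<close>

lemma ex_spectrum:
  fixes f :: "real \<Rightarrow> real"
  assumes refinement: "\<And>x. f x = (\<Prod>k<p. cmod (trig_mean (C k) (of_int a ^ (n k * p + k) * (x / of_int (a ^ p)))))
      * f (x / of_int (a ^ p))"
    and f: "isCont f 0" "f 0 = 1"
  shows "\<exists>\<Lambda>. (\<forall>s\<in>\<Lambda>. \<forall>t\<in>\<Lambda>. s \<noteq> t \<longrightarrow> f (s - t) = 0) \<and>
    (\<forall>x. \<forall>\<eta>>0. \<exists>F. finite F \<and> F \<subseteq> \<Lambda> \<and> (\<Sum>s\<in>F. (f (x + s))\<^sup>2) > 1 - \<eta>)"
proof -
  obtain K where K: "low_pass_filter (a ^ p) w K"
    using low_pass by blast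
  obtain L :: "int set" where L: "finite L" "0 \<in> L"
    "\<And>x. (\<Sum>l\<in>L. (w (x + of_int l / of_int (a ^ p)))\<^sup>2) = 1"
    using w_parseval by blast
  obtain \<Gamma> where \<Gamma>: "finite \<Gamma>" "\<And>x. (\<Sum>g\<in>\<Gamma>. (W (x + g))\<^sup>2) = 1"
    using W_parseval by blast
  interpret compatible_filter "a ^ p" w K L
    using K by (rule compatible_filter.intro)
      (unfold_locales, use L finite_w_zeros in auto)
  have "periodic_zeros = {}"
  proof (rule periodic_zeros_empty)
    fix z R assume z: "w z = 1" "R > 0" "(of_int (a ^ p) ^ R - 1) * z \<in> \<int>"
    show "\<exists>k::int. phi (z + of_int k) \<noteq> 0"
    proof (cases "Gcd differences = 0")
      \<comment> \<open>All digit sets are singletons here. The point \<open>z\<close> may fail to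
        be an integer, but \<open>phi\<close> is constantly 1.\<close>
      case True
      hence "partial_product m z = 1" for m
        by (simp add: partial_product_def w_trivial)
      hence "phi (z + of_int 0) = 1"
        by (simp add: phi_def)
      thus ?thesis
        by (metis zero_neq_one)
    next
      case False
      then obtain m where "z = of_int m"
        using periodic_point_integer[OF _ z] by (auto elim: Ints_cases)
      hence "phi (z + of_int (- m)) = 1"
        by (simp add: phi_at_0)
      thus ?thesis
        by (metis zero_neq_one)
    qed
  qed
  then obtain \<epsilon> where \<epsilon>: "\<epsilon> > 0" "\<And>x. \<exists>k::int. phi (x + of_int k) \<ge> \<epsilon>"
    using equi_positive by blast
  interpret spectral_construction "a ^ p" w K L W \<Gamma> \<epsilon>
    by unfold_locales (use L \<Gamma> \<epsilon> in \<open>auto simp: W_unit W_periodic\<close>)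
  \<comment> \<open>Evaluated at x / scale, the masks in \<open>refinement\<close> become the
    functions \<open>u k\<close> at \<open>x\<close>, so both sides solve the same equation.\<close>
  have eq: "f (x / of_int scale) = transform x" for x
  proof (rule refinement_equation_unique[where A = "of_int (a ^ p)"
        and f = "\<lambda>x. f (x / of_int scale)" and g = transform
        and m = "\<lambda>y. \<Prod>k<p. u k (of_int a ^ (n k * p + k) * y)"])
    show "1 < real_of_int (a ^ p)"
      by (rule A_gt)
    show "norm (\<Prod>k<p. u k (of_int a ^ (n k * p + k) * y)) \<le> 1" for y
      by (auto simp: abs_of_nonneg prod_nonneg u_nonneg u_le_1 intro!: prod_le_1)
    show "f (x / of_int scale) = (\<Prod>k<p. u k (of_int a ^ (n k * p + k) * (x / of_int (a ^ p))))
        * f (x / of_int (a ^ p) / of_int scale)" for x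
      by (subst refinement) (simp add: u_def mult_ac)
    show "transform x = (\<Prod>k<p. u k (of_int a ^ (n k * p + k) * (x / of_int (a ^ p))))
        * transform (x / of_int (a ^ p))" for x
      unfolding transform_def
      by (subst phi_refinement) (simp only: mult.assoc[symmetric] W_refinement)
    show "f (0 / of_int scale) = transform 0"
      by (simp add: f transform_def W_unit phi_at_0)
    show "isCont (\<lambda>x. f (x / of_int scale)) 0"
      by (rule isCont_o2[where g = f]) (auto simp: f)
    show "isCont transform 0"
      unfolding transform_def[abs_def] by (intro continuous_intros isCont_W isCont_phi)
  qed
  define \<Lambda> where "\<Lambda> = (\<lambda>s. s / of_int scale) ` points"
  show ?thesis
  proof (rule exI[of _ \<Lambda>], intro conjI ballI allI impI)
    fix s t assume "s \<in> \<Lambda>" "t \<in> \<Lambda>" "s \<noteq> t"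
    then obtain s' t' where "s' \<in> points" "t' \<in> points" "s' \<noteq> t'"
      "s = s' / of_int scale" "t = t' / of_int scale"
      by (auto simp: \<Lambda>_def)
    thus "f (s - t) = 0"
      using points_orthogonal eq[of "s' - t'"] by (simp add: diff_divide_distrib)
  next
    fix x \<eta> :: real assume "\<eta> > 0"
    then obtain F where F: "finite F" "F \<subseteq> points"
      "(\<Sum>s\<in>F. (transform (of_int scale * x + s))\<^sup>2) > 1 - \<eta>"
      using points_complete by blast
    have "(\<Sum>s\<in>(\<lambda>s. s / of_int scale) ` F. (f (x + s))\<^sup>2) = (\<Sum>s\<in>F. (f (x + s / of_int scale))\<^sup>2)"
      by (subst sum.reindex) (auto simp: inj_on_def)
    also have "\<dots> = (\<Sum>s\<in>F. (transform (of_int scale * x + s))\<^sup>2)"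
      by (simp add: add_divide_distrib flip: eq)
    finally show "\<exists>F. finite F \<and> F \<subseteq> \<Lambda> \<and> (\<Sum>s\<in>F. (f (x + s))\<^sup>2) > 1 - \<eta>"
      using F by (intro exI[of _ "(\<lambda>s. s / of_int scale) ` F"]) (auto simp: \<Lambda>_def)
  qed
qed

end

theorem theorem3p21:
  fixes A a :: int and p :: nat and B :: "int set"
    and n :: "nat \<Rightarrow> nat" and C :: "nat \<Rightarrow> int set"
  assumes "A \<ge> 2" and "finite B" and "0 \<in> B"
    and "a > 0" and "p > 0" and "A = a ^ p"
    and "is_direct_sum {0..<p} (\<lambda>k. (\<lambda>c. a ^ (n k * p + k) * c) ` C k) B"
    and "\<forall>k\<in>{0..<p}. \<exists>L :: int set.
           set_has_spectrum (real_of_int ` C k) ((\<lambda>l. 1 / real_of_int a * real_of_int l) ` L)"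
    and "Gcd (C 0) = 1"
  shows "spectral_measure (invariant_measure (affine_ifs A) B)"
proof -
  have "a \<noteq> 1"
    using \<open>A \<ge> 2\<close> \<open>A = a ^ p\<close> by auto
  hence a: "a \<ge> 2"
    using \<open>a > 0\<close> by simp
  have B: "finite B" "B \<noteq> {}"
    using \<open>finite B\<close> \<open>0 \<in> B\<close> by auto
  interpret digit_masks a p n C
  proof
    fix k assume "k < p"
    hence "k \<in> {0..<p}" by simp
    then obtain L :: "int set" where L:
      "set_has_spectrum (real_of_int ` C k) ((\<lambda>l. 1 / real_of_int a * real_of_int l) ` L)"
      using assms(8) by blast
    note * = set_has_spectrum_trig_mean[OF L \<open>a > 0\<close>]
    show "finite (C k)" "C k \<noteq> {}"
      by (rule *)+
    show "\<exists>L::int set. finite L \<and>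
        (\<forall>x. (\<Sum>l\<in>L. (cmod (trig_mean (C k) (x + of_int l / of_int a)))\<^sup>2) = 1)"
      using *(3,4) by blast
  qed (use a \<open>p > 0\<close> in auto)
  define M where "M = invariant_measure (affine_ifs A) B"
  have inv: "is_invariant_measure (affine_ifs A) B M"
    unfolding M_def by (rule is_invariant_measure_invariant_measure[OF \<open>A \<ge> 2\<close> B])
  hence M: "prob_space M" "sets M = sets borel"
    by (auto simp: is_invariant_measure_def)
  obtain R where R: "AE x in M. \<bar>x\<bar> \<le> R"
    using AE_invariant_measure_bounded[OF \<open>A \<ge> 2\<close> B] unfolding M_def by blast
  define f where "f x = cmod (fourier_transform M x)" for x
  have mean_B: "trig_mean B y = (\<Prod>k<p. trig_mean (C k) (of_int a ^ (n k * p + k) * y))" for y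
    using trig_mean_direct_sum[OF assms(7), of y] C
    by (simp add: trig_mean_dilation atLeast0LessThan)
  have f_refinement: "f x = (\<Prod>k<p. cmod (trig_mean (C k) (of_int a ^ (n k * p + k) * (x / of_int (a ^ p)))))
      * f (x / of_int (a ^ p))" for x
    unfolding f_def
    by (subst fourier_transform_invariant[OF \<open>A \<ge> 2\<close> B inv])
       (simp add: mean_B norm_mult prod_norm \<open>A = a ^ p\<close>)
  have f_cont: "isCont f 0"
    unfolding f_def[abs_def] by (intro continuous_intros isCont_fourier_transform M)
  have f_0: "f 0 = 1"
    by (simp add: f_def fourier_transform_0[OF M])
  obtain \<Lambda> where orth: "\<And>s t. s \<in> \<Lambda> \<Longrightarrow> t \<in> \<Lambda> \<Longrightarrow> s \<noteq> t \<Longrightarrow> f (s - t) = 0"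
    and complete: "\<And>x \<eta>. \<eta> > 0 \<Longrightarrow>
      \<exists>F. finite F \<and> F \<subseteq> \<Lambda> \<and> (\<Sum>s\<in>F. (f (x + s))\<^sup>2) > 1 - \<eta>"
    using ex_spectrum[OF f_refinement f_cont f_0] by blast
  \<comment> \<open>Evenness reconciles the sums x + s of the construction with the differences
    \<xi> - s in the Fourier coefficients.\<close>
  have f_minus: "f (- x) = f x" for x
    unfolding f_def by (metis cnj_fourier_transform[OF M] complex_mod_cnj)
  have "is_spectrum M \<Lambda>"
  proof (rule is_spectrumI[OF M R])
    show "fourier_transform M (s - t) = 0" if "s \<in> \<Lambda>" "t \<in> \<Lambda>" "s \<noteq> t" for s t
      using orth[OF that] by (simp add: f_def)
    show "\<exists>F. finite F \<and> F \<subseteq> \<Lambda> \<and> (\<Sum>s\<in>F. (cmod (fourier_transform M (\<xi> - s)))\<^sup>2) > 1 - \<eta>"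
      if "\<eta> > 0" for \<xi> \<eta>
    proof -
      have "f (- \<xi> + s) = cmod (fourier_transform M (\<xi> - s))" for s
        using f_minus[of "\<xi> - s"] by (simp add: f_def)
      thus ?thesis
        using complete[OF that, of "- \<xi>"] by simp
    qed
  qed
  thus ?thesis
    using M prob_space.finite_measure[OF M(1)]
    unfolding spectral_measure_def M_def by blast
qed

end
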